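(* Let $(\mathbb{B},\|\cdot\|)$ be a separable $\beta$-smooth Banach space and let $(X_n)_{n\ge1}$ be $\mathbb{B}$-valued random variables adapted to a filtration $(\mathcal{F}_n)_{n\ge0}$ with $\mathbb{E}(X_n\mid\mathcal{F}_{n-1})=\mu$ for all $n\ge1$ (some unknown $\mu\in\mathbb{B}$) and $\sup_{n\ge1}\mathbb{E}(\|X_n-\mu\|^p\mid\mathcal{F}_{n-1})\le v<\infty$ for known $p\in(1,2]$, $v>0$. Let $h:\mathbb{R}_{\ge0}\to\mathbb{R}_{\ge0}$ satisfy $\sum_{n=1}^\infty h(n)^{-1}\le1$, let $n_0$ be a positive integer, and let $k:\mathbb{N}_0\to\mathbb{N}_0$ be increasing with (i) $k(\lfloor\log_2 n\rfloor)=o(n)$ and (ii) $k(\ell)\le\ell/2$ for all $\ell\ge n_0$. Let $\widehat{Z}_j:=\widehat{Z}(X_1,\dots,X_{k(j)})$ for a fixed measurable map $\widehat{Z}$, and suppose $r:(0,1)\times\mathbb{N}_0\to\mathbb{R}$ satisfies $\mathbb{P}(\|\widehat{Z}_j-\mu\|\ge r(\delta,k(j)))\le\delta$ for all $\delta\in(0,1)$ and $j\in\mathbb{N}_0$. Fix $\delta\in(0,1)$ and for $j\ge1$ set $\delta_j:=\delta/h(j)$, \[ \mathfrak{C}_p(j):=\big(\beta\mathfrak{C}_p(\mathbb{B})+2^{p-1}K_p\big)\big(v+r(\delta_j/2,k(j))^p\big),\qquad \lambda_j:=\left(\frac{\beta\log(4/\delta_j)}{2^j\mathfrak{C}_p(j)}\right)^{1/p},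 \] \[ \widehat{\mu}_n(j):=\frac{1}{n-k(j)}\sum_{m=k(j)}^n\left\{\mathtt{Trunc}(\lambda_j(X_m-\widehat{Z}_j))(X_m-\widehat{Z}_j)+\widehat{Z}_j\right\}, \] and $\widehat{\mu}_n:=\widehat{\mu}_n(j)$ for the unique $j\ge1$ with $n\in[2^j,2^{j+1})$. Then with probability at least $1-\delta$, simultaneously for all $n\ge n_0$, \[ \|\widehat{\mu}_n-\mu\|\le\mathfrak{B}_p(\mathbb{B})(v+r_n^p)^{1/p}\left(\beta\frac{\log\!\big(4h(\lfloor\log_2 n\rfloor)/\delta\big)}{n-k(\lfloor\log_2 n\rfloor)}\right)^{(p-1)/p}, \] where $r_n:=r\big(h(\lfloor\log_2 n\rfloor)^{-1}\delta/2,\,k(\lfloor\log_2 n\rfloor)\big)$ and $\mathfrak{B}_p(\mathbb{B}):=[2^{(p-1)/p}+2^{1/p}](\beta\mathfrak{C}_p(\mathbb{B})+K_p2^{p-1})^{1/p}$.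
   Context: $\beta$-smooth: the norm $f=\|\cdot\|$ satisfies $f(0)=0$, $|f(x+y)-f(x)|\le\|y\|$ and $f^2(x+y)+f^2(x-y)\le2f^2(x)+2\beta^2\|y\|^2$ for all $x,y$. $\mathtt{Trunc}(x):=\min\{1,1/\|x\|\}$ ($\mathtt{Trunc}(0)=1$). $K_p:=\frac1p\left(\frac{p-1}{p}\right)^{p-1}$. $\mathfrak{C}_p(\mathbb{B}):=2^{p-1}\frac{e^{2/\beta}-2/\beta-1}{(2/\beta)^2}$ if $\mathbb{B}$ is a Hilbert space and $\mathfrak{C}_p(\mathbb{B}):=2^{p+1}\frac{e^{2/\beta}-2/\beta-1}{(2/\beta)^2}$ otherwise.
   Formalization: The sum defining the estimator runs over m = k(j)+1,…,n instead of m = k(j),…,n (as printed it has one term too many, or uses the undefined X_0, and the bound fails for constant X_n = μ), and the bound is claimed for n ≥ max(n_0, 2), since the estimator is undefined at n = 1. *)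

theory Defs
  imports "HOL-Probability.Probability" "HOL-Library.Landau_Symbols"
begin

text \<open>beta-smoothness of the norm f = norm (conditions of the paper, written out).\<close>
definition beta_smooth :: "real \<Rightarrow> 'b::real_normed_vector itself \<Rightarrow> bool" where
  "beta_smooth \<beta> (_::'b itself) \<longleftrightarrow>
     norm (0::'b) = 0 \<and>
     (\<forall>x y::'b. \<bar>norm (x + y) - norm x\<bar> \<le> norm y) \<and>
     (\<forall>x y::'b. (norm (x + y))\<^sup>2 + (norm (x - y))\<^sup>2 \<le> 2 * (norm x)\<^sup>2 + 2 * \<beta>\<^sup>2 * (norm y)\<^sup>2)"

definition is_hilbert :: "'b::real_normed_vector itself \<Rightarrow> bool" where
  "is_hilbert (_::'b itself) \<longleftrightarrow>
     (\<exists>ip :: 'b \<Rightarrow> 'b \<Rightarrow> real.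
        (\<forall>x y z. ip (x + y) z = ip x z + ip y z) \<and>
        (\<forall>c x y. ip (c *\<^sub>R x) y = c * ip x y) \<and>
        (\<forall>x y. ip x y = ip y x) \<and>
        (\<forall>x. norm x = sqrt (ip x x)))"

definition Trunc :: "'b::real_normed_vector \<Rightarrow> real" where
  "Trunc x = (if x = 0 then 1 else min 1 (1 / norm x))"

definition K_const :: "real \<Rightarrow> real" where
  "K_const p = (1 / p) * ((p - 1) / p) powr (p - 1)"

definition C_space :: "real \<Rightarrow> real \<Rightarrow> 'b::real_normed_vector itself \<Rightarrow> real" where
  "C_space p \<beta> T =
     (if is_hilbert T then 2 powr (p - 1) else 2 powr (p + 1)) *
     ((exp (2 / \<beta>) - 2 / \<beta> - 1) / (2 / \<beta>)\<^sup>2)"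

definition B_space :: "real \<Rightarrow> real \<Rightarrow> 'b::real_normed_vector itself \<Rightarrow> real" where
  "B_space p \<beta> T =
     (2 powr ((p - 1) / p) + 2 powr (1 / p)) *
     (\<beta> * C_space p \<beta> T + K_const p * 2 powr (p - 1)) powr (1 / p)"

definition flog2 :: "nat \<Rightarrow> nat" where
  "flog2 n = nat \<lfloor>log 2 (real n)\<rfloor>"

definition muhat_est :: "(nat \<Rightarrow> 'a \<Rightarrow> 'b::real_normed_vector) \<Rightarrow> 'b \<Rightarrow> real \<Rightarrow> nat \<Rightarrow> nat \<Rightarrow> 'a \<Rightarrow> 'b" where
  "muhat_est X Z lam kj n \<omega> = (1 / (real n - real kj)) *\<^sub>R
     (\<Sum>m\<in>{kj<..n}. Trunc (lam *\<^sub>R (X m \<omega> - Z)) *\<^sub>R (X m \<omega> - Z) + Z)"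

end

theory Submission
  imports Defs "HOL-Real_Asymp.Real_Asymp"
begin

text \<open>
  Fix a block \<open>n \<in> [2^j, 2^(j+1))\<close> and restrict to the event \<open>norm (Z - \<mu>) < R\<close>, which is measurable at
  time \<open>k j\<close>. The truncated increments \<open>T\<close>, scaled by \<open>lam\<close>, have norm at most 1, and the \<open>p\<close>-th moment
  bound controls both their conditional second moment and the bias of their conditional mean \<open>D\<close>.

  For the martingale with differences \<open>T - D\<close>, Pinelis' argument makes \<open>cosh (norm S / \<beta>)\<close> grow by a factor
  at most \<open>exp \<kappa>\<close> per step in conditional expectation, so a maximal inequality bounds \<open>norm S\<close> uniformly
  over the block. The choice of \<open>lam\<close> balances deviation and bias, and a union bound over \<open>j\<close> finishes.

  Smoothness is used only through second differences: it gives
  \<open>cosh (norm (x + y)) + cosh (norm (x - y)) \<le> 2 * cosh (norm x) * exp (\<beta>\<^sup>2 * (norm y)\<^sup>2 / 2)\<close>, which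
  integrates to a second-order expansion of \<open>cosh \<circ> norm\<close>, and it makes the directional derivative of the
  norm linear. That derivative at \<open>D\<close> is a norming functional depending measurably on the point; pairing
  with it replaces duality in all conditional-expectation estimates.
\<close>

subsection \<open>Directional derivative of the norm\<close>

text \<open>The smoothness inequality supplies no second derivative, and the norm has a kink at 0.
  The hyperbolic cosine removes the kink: its first-order term carries the factor
  \<open>sinh (norm x)\<close>, which is 0 at 0, so the default value of \<open>norm_deriv\<close>
  at base point 0 does no harm. Origin of the constants: truncated increments and their conditional
  means have norm at most 1, so centred increments divided by \<beta> have norm at most
  \<open>2 / \<beta>\<close>, the argument of \<open>exp\<close> in \<open>C_space\<close>. Centring
  costs a factor 1 in a Hilbert space and 4 otherwise, whence \<open>2 powr (p - 1)\<close> against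
  \<open>2 powr (p + 1)\<close>. The power \<open>2 powr (p - 1)\<close> itself comes from splitting
  \<open>X - Z\<close> into \<open>X - \<mu>\<close> and \<open>Z - \<mu>\<close>, and
  \<open>K_const p\<close> from the bias of truncation. Half of a block's error probability goes to
  the pilot \<open>Z\<close> and half to the martingale; together with the 2 lost in
  \<open>exp x \<le> 2 * cosh x\<close> this puts a 4 into the logarithm. The two powers of 2 in
  \<open>B_space\<close> are the price of tuning \<open>lam\<close> to \<open>2 ^ j\<close> instead
  of the exact sample size.\<close>

definition norm_deriv :: "'b::real_normed_vector \<Rightarrow> 'b \<Rightarrow> real" where
  "norm_deriv x y = (if x = 0 then 0 else (INF s\<in>{0<..}. (norm (x + s *\<^sub>R y) - norm x) / s))"

text \<open>The norm is convex along the line, and \<open>x + s *\<^sub>R y\<close> divides the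
  segment from \<open>x\<close> to \<open>x + t *\<^sub>R y\<close>. Monotone quotients turn the
  infimum in \<open>norm_deriv\<close> into the limit as \<open>s\<close> decreases to 0.\<close>

lemma norm_quotient_mono:
  fixes x y :: "'b::real_normed_vector"
  assumes "0 < s" "s \<le> t"
  shows "(norm (x + s *\<^sub>R y) - norm x) / s \<le> (norm (x + t *\<^sub>R y) - norm x) / t"
proof -
  have t: "t > 0" using assms by simp
  have "x + s *\<^sub>R y = (1 - s / t) *\<^sub>R x + (s / t) *\<^sub>R (x + t *\<^sub>R y)"
    using t by (simp add: algebra_simps)
  then have "norm (x + s *\<^sub>R y) \<le> \<bar>1 - s / t\<bar> * norm x + \<bar>s / t\<bar> * norm (x + t *\<^sub>R y)"
    by (metis norm_scaleR norm_triangle_ineq)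
  also have "\<dots> = (1 - s / t) * norm x + (s / t) * norm (x + t *\<^sub>R y)"
    using assms t by simp
  finally have "norm (x + s *\<^sub>R y) - norm x \<le> (s / t) * (norm (x + t *\<^sub>R y) - norm x)"
    by (simp add: algebra_simps)
  then show ?thesis using assms t by (simp add: field_simps)
qed

lemma norm_quotient_abs_le:
  fixes x y :: "'b::real_normed_vector"
  assumes "0 < s"
  shows "\<bar>(norm (x + s *\<^sub>R y) - norm x) / s\<bar> \<le> norm y"
proof -
  have "\<bar>norm (x + s *\<^sub>R y) - norm x\<bar> \<le> norm (s *\<^sub>R y)"
    using norm_triangle_ineq3[of "x + s *\<^sub>R y" x] by simp
  then show ?thesis using assms by (simp add: field_simps)
qed

lemma bdd_below_norm_quotient:
  "bdd_below ((\<lambda>s. (norm (x + s *\<^sub>R y) - norm x) / s) ` {0<..})"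
proof (rule bdd_belowI2)
  fix s :: real assume "s \<in> {0<..}"
  then show "- norm y \<le> (norm (x + s *\<^sub>R y) - norm x) / s"
    using norm_quotient_abs_le[of s x y, unfolded abs_le_iff] by auto
qed

lemma norm_deriv_le_quotient:
  assumes "x \<noteq> 0" "0 < s"
  shows "norm_deriv x y \<le> (norm (x + s *\<^sub>R y) - norm x) / s"
  unfolding norm_deriv_def using assms by (auto intro: cINF_lower[OF bdd_below_norm_quotient])

lemma norm_deriv_lessE:
  assumes "x \<noteq> 0" "norm_deriv x y < a"
  obtains t where "t > 0" "(norm (x + t *\<^sub>R y) - norm x) / t < a"
proof -
  have "(INF s\<in>{0<..}. (norm (x + s *\<^sub>R y) - norm x) / s) < a"
    using assms by (simp add: norm_deriv_def)
  then have "\<exists>t\<in>{0<..}. (norm (x + t *\<^sub>R y) - norm x) / t < a"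
    by (subst (asm) cINF_less_iff[OF _ bdd_below_norm_quotient]) auto
  then show ?thesis using that by auto
qed

lemma norm_deriv_tendsto:
  assumes "x \<noteq> 0"
  shows "((\<lambda>s. (norm (x + s *\<^sub>R y) - norm x) / s) \<longlongrightarrow> norm_deriv x y) (at_right 0)"
proof (rule order_tendstoI)
  fix a assume "a < norm_deriv x y"
  then show "\<forall>\<^sub>F s in at_right 0. a < (norm (x + s *\<^sub>R y) - norm x) / s"
    using less_le_trans[OF _ norm_deriv_le_quotient[OF assms]]
    by (auto simp: eventually_at_right_field intro!: exI[of _ 1])
next
  fix a assume "norm_deriv x y < a"
  then obtain t where t: "t > 0" "(norm (x + t *\<^sub>R y) - norm x) / t < a"
    using norm_deriv_lessE[OF assms] by blast
  have "(norm (x + s *\<^sub>R y) - norm x) / s < a" if "0 < s" "s < t" for s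
    using le_less_trans[OF norm_quotient_mono[OF that(1) less_imp_le[OF that(2)]] t(2)] .
  then show "\<forall>\<^sub>F s in at_right 0. (norm (x + s *\<^sub>R y) - norm x) / s < a"
    unfolding eventually_at_right_field using t(1) by blast
qed

lemma norm_deriv_abs_le: "\<bar>norm_deriv x y\<bar> \<le> norm y"
proof (cases "x = 0")
  case False
  have "((\<lambda>s. \<bar>(norm (x + s *\<^sub>R y) - norm x) / s\<bar>) \<longlongrightarrow> \<bar>norm_deriv x y\<bar>) (at_right 0)"
    by (intro tendsto_rabs norm_deriv_tendsto False)
  then show ?thesis
    by (rule tendsto_upperbound)
       (auto simp: eventually_at_right_field norm_quotient_abs_le simp del: abs_divide intro!: exI[of _ 1])
qed (simp add: norm_deriv_def)

lemma norm_deriv_self: "norm_deriv x x = norm x"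
proof (cases "x = 0")
  case False
  have "(norm (x + s *\<^sub>R x) - norm x) / s = norm x" if "s > 0" for s
  proof -
    have "x + s *\<^sub>R x = (1 + s) *\<^sub>R x" by (simp add: algebra_simps)
    then have "norm (x + s *\<^sub>R x) = (1 + s) * norm x" using that by (metis abs_of_pos add_pos_pos norm_scaleR zero_less_one)
    then show ?thesis using that by (simp add: field_simps)
  qed
  then show ?thesis using False by (simp add: norm_deriv_def)
qed (simp add: norm_deriv_def)

text \<open>The point \<open>x + s *\<^sub>R (y + z)\<close> is the midpoint of
  \<open>x + (2 * s) *\<^sub>R y\<close> and \<open>x + (2 * s) *\<^sub>R z\<close>, so the triangle
  inequality passes to the limit. Sublinearity holds for any norm; smoothness enters only with the
  reflection \<open>y\<close> to \<open>- y\<close>.\<close>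

lemma norm_deriv_add_le:
  "norm_deriv x (y + z) \<le> norm_deriv x y + norm_deriv x z"
proof (cases "x = 0")
  case False
  let ?q = "\<lambda>y s. (norm (x + s *\<^sub>R y) - norm x) / s"
  have half: "filterlim (\<lambda>s::real. 2 * s) (at_right 0) (at_right 0)"
    by real_asymp
  have "((\<lambda>s. ?q y (2 * s) + ?q z (2 * s)) \<longlongrightarrow> norm_deriv x y + norm_deriv x z) (at_right 0)"
    by (intro tendsto_add filterlim_compose[OF norm_deriv_tendsto[OF False] half])
  moreover have "\<forall>\<^sub>F s in at_right 0. ?q (y + z) s \<le> ?q y (2 * s) + ?q z (2 * s)"
  proof -
    have "?q (y + z) s \<le> ?q y (2 * s) + ?q z (2 * s)" if "s > 0" for s
    proof -
      have "2 *\<^sub>R (x + s *\<^sub>R (y + z)) = (x + (2 * s) *\<^sub>R y) + (x + (2 * s) *\<^sub>R z)"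
        by (simp add: algebra_simps scaleR_2)
      then have "2 * norm (x + s *\<^sub>R (y + z)) \<le> norm (x + (2 * s) *\<^sub>R y) + norm (x + (2 * s) *\<^sub>R z)"
        by (metis norm_scaleR norm_triangle_ineq abs_numeral)
      moreover have "A / s \<le> P / (2 * s) + Q / (2 * s)" if "2 * A \<le> P + Q" for A P Q :: real
        using that \<open>s > 0\<close> by (simp add: field_simps)
      ultimately show ?thesis by simp
    qed
    then show ?thesis by (auto simp: eventually_at_right_field intro!: exI[of _ 1])
  qed
  ultimately show ?thesis
    using norm_deriv_tendsto[OF False] by (intro tendsto_le[of "at_right 0"]) auto
qed (simp add: norm_deriv_def)

lemma norm_deriv_scale_pos:
  assumes "c > 0"
  shows "norm_deriv x (c *\<^sub>R y) = c * norm_deriv x y"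
proof (cases "x = 0")
  case False
  let ?q = "\<lambda>y s. (norm (x + s *\<^sub>R y) - norm x) / s"
  have "filterlim (\<lambda>s::real. c * s) (at_right 0) (at_right 0)"
    using assms by real_asymp
  then have "((\<lambda>s. c * ?q y (c * s)) \<longlongrightarrow> c * norm_deriv x y) (at_right 0)"
    by (intro tendsto_mult_left filterlim_compose[OF norm_deriv_tendsto[OF False]])
  moreover have "c * ?q y (c * s) = ?q (c *\<^sub>R y) s" for s
    using assms by (simp add: mult.commute)
  ultimately have "(?q (c *\<^sub>R y) \<longlongrightarrow> c * norm_deriv x y) (at_right 0)" by simp
  then show ?thesis
    using tendsto_unique[OF _ norm_deriv_tendsto[OF False]] by force
qed (simp add: norm_deriv_def)

lemma beta_smoothD:
  fixes x y :: "'b::real_normed_vector"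
  assumes "beta_smooth \<beta> TYPE('b)"
  shows "(norm (x + y))\<^sup>2 + (norm (x - y))\<^sup>2 \<le> 2 * (norm x)\<^sup>2 + 2 * \<beta>\<^sup>2 * (norm y)\<^sup>2"
  using assms by (simp add: beta_smooth_def)

lemma beta_smooth_norm_le:
  fixes y :: "'b::real_normed_vector"
  assumes "beta_smooth \<beta> TYPE('b)"
  shows "(norm y)\<^sup>2 \<le> \<beta>\<^sup>2 * (norm y)\<^sup>2"
  using beta_smoothD[OF assms, of 0 y] by simp

text \<open>Smoothness makes \<open>norm (x + s *\<^sub>R y) + norm (x - s *\<^sub>R y) - 2 * norm
  x\<close> at most of order \<open>s\<^sup>2\<close>, so the two one-sided derivatives cancel.
  Oddness is what upgrades the sublinear \<open>norm_deriv x\<close> to a linear functional.\<close>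

lemma norm_deriv_minus:
  fixes x y :: "'b::real_normed_vector"
  assumes "beta_smooth \<beta> TYPE('b)"
  shows "norm_deriv x (- y) = - norm_deriv x y"
proof (cases "x = 0")
  case False
  let ?q = "\<lambda>y s. (norm (x + s *\<^sub>R y) - norm x) / s"
  have "((\<lambda>s. ?q y s + ?q (- y) s) \<longlongrightarrow> norm_deriv x y + norm_deriv x (- y)) (at_right 0)"
    by (intro tendsto_add norm_deriv_tendsto False)
  moreover have "((\<lambda>s. \<beta>\<^sup>2 * (norm y)\<^sup>2 / norm x * s) \<longlongrightarrow> \<beta>\<^sup>2 * (norm y)\<^sup>2 / norm x * 0) (at_right 0)"
    by (intro tendsto_intros)
  moreover have "\<forall>\<^sub>F s in at_right 0. ?q y s + ?q (- y) s \<le> \<beta>\<^sup>2 * (norm y)\<^sup>2 / norm x * s"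
  proof -
    have "?q y s + ?q (- y) s \<le> \<beta>\<^sup>2 * (norm y)\<^sup>2 / norm x * s" if s: "s > 0" for s
    proof -
      define a b \<rho> where ab: "a = norm (x + s *\<^sub>R y)" "b = norm (x - s *\<^sub>R y)" "\<rho> = norm x"
      have \<rho>: "\<rho> > 0" using False by (simp add: ab)
      have 1: "a\<^sup>2 + b\<^sup>2 \<le> 2 * \<rho>\<^sup>2 + 2 * \<beta>\<^sup>2 * (s * norm y)\<^sup>2"
        using beta_smoothD[OF assms, of x "s *\<^sub>R y"] s by (simp add: ab)
      \<comment> \<open>Chosen so that \<open>4 * e * \<rho>\<close> is the cross term of
        \<open>(2 * \<rho> + e)\<^sup>2\<close>: square roots can then be taken, and
        \<open>e / s\<close> still tends to 0 with \<open>s\<close>.\<close>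
      define e where "e = \<beta>\<^sup>2 * (s * norm y)\<^sup>2 / \<rho>"
      have e: "e \<ge> 0" "e * \<rho> = \<beta>\<^sup>2 * (s * norm y)\<^sup>2" using \<rho> by (auto simp: e_def)
      have "(a + b)\<^sup>2 \<le> 2 * (a\<^sup>2 + b\<^sup>2)"
        using sum_squares_bound[of a b] by (simp add: power2_sum)
      also have "\<dots> \<le> 4 * \<rho>\<^sup>2 + 4 * e * \<rho>" using 1 e(2) by simp
      also have "\<dots> \<le> (2 * \<rho> + e)\<^sup>2" by (simp add: power2_sum power_mult_distrib)
      finally have "a + b \<le> 2 * \<rho> + e" by (rule power2_le_imp_le) (use \<rho> e in simp)
      then have "(a - \<rho>) / s + (b - \<rho>) / s \<le> e / s"
        using s by (simp add: add_divide_distrib[symmetric] divide_right_mono)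
      also have "e / s = \<beta>\<^sup>2 * (norm y)\<^sup>2 / \<rho> * s"
        using s by (simp add: e_def power2_eq_square)
      finally show ?thesis by (simp add: ab)
    qed
    then show ?thesis by (auto simp: eventually_at_right_field intro!: exI[of _ 1])
  qed
  ultimately have "norm_deriv x y + norm_deriv x (- y) \<le> \<beta>\<^sup>2 * (norm y)\<^sup>2 / norm x * 0"
    by (intro tendsto_le[of "at_right 0"]) auto
  moreover have "norm_deriv x 0 = 0" using norm_deriv_abs_le[of x 0] by simp
  then have "0 \<le> norm_deriv x y + norm_deriv x (- y)"
    using norm_deriv_add_le[of x y "- y"] by simp
  ultimately show ?thesis by simp
qed (simp add: norm_deriv_def)

lemma bounded_linear_norm_deriv:
  fixes x :: "'b::real_normed_vector"
  assumes "beta_smooth \<beta> TYPE('b)"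
  shows "bounded_linear (norm_deriv x)"
proof (rule bounded_linear_intro[where K = 1])
  fix y z :: 'b
  show "norm_deriv x (y + z) = norm_deriv x y + norm_deriv x z"
    using norm_deriv_add_le[of x y z] norm_deriv_add_le[of x "- y" "- z"]
      norm_deriv_minus[OF assms, of x "y + z"]
    by (simp add: norm_deriv_minus[OF assms])
  show "norm (norm_deriv x y) \<le> norm y * 1" using norm_deriv_abs_le[of x y] by simp
next
  fix c :: real and y :: 'b
  consider "c > 0" | "c = 0" | "- c > 0" by linarith
  then show "norm_deriv x (c *\<^sub>R y) = c *\<^sub>R norm_deriv x y"
  proof cases
    case 2
    then show ?thesis using norm_deriv_abs_le[of x 0] by simp
  next
    case 3
    have "norm_deriv x (c *\<^sub>R y) = norm_deriv x ((- c) *\<^sub>R (- y))" by simp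
    also have "\<dots> = (- c) * norm_deriv x (- y)" by (rule norm_deriv_scale_pos[OF 3])
    finally show ?thesis by (simp add: norm_deriv_minus[OF assms])
  qed (simp add: norm_deriv_scale_pos)
qed

text \<open>An infimum of functions continuous in the base point is upper semicontinuous; the same
  fact for \<open>- y\<close>, with oddness, gives lower semicontinuity.\<close>

lemma norm_deriv_continuous_base:
  fixes x y :: "'b::real_normed_vector"
  assumes "beta_smooth \<beta> TYPE('b)" "x \<noteq> 0" "X \<longlonglongrightarrow> x"
  shows "(\<lambda>i. norm_deriv (X i) y) \<longlonglongrightarrow> norm_deriv x y"
proof -
  have ev: "\<forall>\<^sub>F i in sequentially. X i \<noteq> 0"
    using assms(2,3) by (rule tendsto_imp_eventually_ne[rotated])
  have upper: "\<forall>\<^sub>F i in sequentially. norm_deriv (X i) y < a" if "norm_deriv x y < a" for a y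
  proof -
    obtain t where t: "t > 0" "(norm (x + t *\<^sub>R y) - norm x) / t < a"
      using norm_deriv_lessE[OF assms(2) \<open>norm_deriv x y < a\<close>] by blast
    have "(\<lambda>i. (norm (X i + t *\<^sub>R y) - norm (X i)) / t) \<longlonglongrightarrow> (norm (x + t *\<^sub>R y) - norm x) / t"
      using t by (intro tendsto_intros assms) auto
    then have "\<forall>\<^sub>F i in sequentially. (norm (X i + t *\<^sub>R y) - norm (X i)) / t < a"
      using t(2) by (rule order_tendstoD)
    then show ?thesis using ev
      by eventually_elim (use t norm_deriv_le_quotient le_less_trans in blast)
  qed
  show ?thesis
  proof (rule order_tendstoI)
    fix a assume "a < norm_deriv x y"
    then have "norm_deriv x (- y) < - a" by (simp add: norm_deriv_minus[OF assms(1)])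
    from upper[OF this] show "\<forall>\<^sub>F i in sequentially. a < norm_deriv (X i) y"
      by (simp add: norm_deriv_minus[OF assms(1)])
  qed (rule upper)
qed

text \<open>In a Hilbert space \<open>norm x * norm_deriv x y\<close> is the inner product, so the
  squared norm expands exactly. This exactness is the source of the factor 1 in the Hilbert case of
  \<open>is_cond_exp_sq_le\<close>.\<close>

lemma norm_deriv_inner:
  fixes x y :: "'b::real_normed_vector" and ip :: "'b \<Rightarrow> 'b \<Rightarrow> real"
  assumes add: "\<And>x y z. ip (x + y) z = ip x z + ip y z"
    and scale: "\<And>c x y. ip (c *\<^sub>R x) y = c * ip x y"
    and sym: "\<And>x y. ip x y = ip y x"
    and norm: "\<And>x. norm x = sqrt (ip x x)"
  shows "(norm (x + y))\<^sup>2 = (norm x)\<^sup>2 + 2 * norm x * norm_deriv x y + (norm y)\<^sup>2"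
proof -
  have nonneg: "ip z z \<ge> 0" for z using norm_ge_zero[of z] unfolding norm by (metis real_sqrt_ge_0_iff)
  have sq: "(norm z)\<^sup>2 = ip z z" for z unfolding norm using nonneg by simp
  have expand: "(norm (x + s *\<^sub>R y))\<^sup>2 = (norm x)\<^sup>2 + 2 * s * ip x y + s\<^sup>2 * (norm y)\<^sup>2" for s
  proof -
    have 1: "ip u (v + w) = ip u v + ip u w" for u v w by (metis add sym)
    have 2: "ip u (c *\<^sub>R w) = c * ip u w" for u c w by (metis scale sym)
    show ?thesis unfolding sq by (simp add: 1 2 add scale sym[of y x] power2_eq_square algebra_simps)
  qed
  have "norm x * norm_deriv x y = ip x y"
  proof (cases "x = 0")
    case True
    have "ip 0 y = 0" using scale[of 0 0 y] by simp
    then show ?thesis using True by simp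
  next
    case False
    let ?q = "\<lambda>s. (norm (x + s *\<^sub>R y) - norm x) / s"
    \<comment> \<open>Multiplication by the sum of the two norms turns the quotient into a
      difference quotient of the squared norm, which is a polynomial in \<open>s\<close>.\<close>
    have "((\<lambda>s. (norm (x + s *\<^sub>R y) + norm x) * ?q s) \<longlongrightarrow> (norm (x + 0 *\<^sub>R y) + norm x) * norm_deriv x y) (at_right 0)"
      by (intro tendsto_mult norm_deriv_tendsto False) (intro tendsto_intros)
    moreover have "((\<lambda>s. (norm (x + s *\<^sub>R y) + norm x) * ?q s) \<longlongrightarrow> 2 * ip x y) (at_right 0)"
    proof (rule Lim_transform_eventually)
      show "((\<lambda>s. 2 * ip x y + s * (norm y)\<^sup>2) \<longlongrightarrow> 2 * ip x y) (at_right 0)"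
        by real_asymp
      have "2 * ip x y + s * (norm y)\<^sup>2 = (norm (x + s *\<^sub>R y) + norm x) * ?q s" if "s > 0" for s
      proof -
        have "(norm (x + s *\<^sub>R y) + norm x) * ?q s = ((norm (x + s *\<^sub>R y))\<^sup>2 - (norm x)\<^sup>2) / s"
          by (simp add: power2_eq_square algebra_simps)
        then show ?thesis unfolding expand using that by (simp add: field_simps power2_eq_square)
      qed
      then show "\<forall>\<^sub>F s in at_right 0. 2 * ip x y + s * (norm y)\<^sup>2 = (norm (x + s *\<^sub>R y) + norm x) * ?q s"
        by (auto simp: eventually_at_right_field intro!: exI[of _ 1])
    qed
    ultimately have "(norm (x + 0 *\<^sub>R y) + norm x) * norm_deriv x y = 2 * ip x y"
      by (intro tendsto_unique[rotated]) auto
    then show ?thesis by simp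
  qed
  then show ?thesis using expand[of 1] by simp
qed

subsection \<open>Second-order expansion of the hyperbolic cosine of the norm\<close>

lemma sinh_le_mult_cosh: "0 \<le> x \<Longrightarrow> sinh x \<le> x * cosh (x::real)"
proof -
  assume x: "0 \<le> x"
  define f where "f = (\<lambda>x::real. x * cosh x - sinh x)"
  have "f 0 \<le> f x"
  proof (rule DERIV_nonneg_imp_nondecreasing[OF x])
    fix t :: real assume t: "0 \<le> t" "t \<le> x"
    have "(f has_real_derivative t * sinh t) (at t)"
      unfolding f_def by (rule derivative_eq_intros refl)+ simp
    then show "\<exists>y. (f has_real_derivative y) (at t) \<and> 0 \<le> y"
      using t by auto
  qed
  then show ?thesis by (simp add: f_def)
qed

text \<open>The function \<open>cosh x * exp (- x\<^sup>2 / 2)\<close> is nonincreasing on the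
  nonnegative reals because \<open>sinh x \<le> x * cosh x\<close>. It converts inequalities between
  squares, the only kind that smoothness provides, into inequalities between hyperbolic
  cosines.\<close>

lemma cosh_le_cosh_exp:
  fixes m \<rho> :: real
  assumes "0 \<le> \<rho>" "\<rho> \<le> m"
  shows "cosh m \<le> cosh \<rho> * exp ((m\<^sup>2 - \<rho>\<^sup>2) / 2)"
proof -
  define f where "f = (\<lambda>x::real. cosh x * exp (- x\<^sup>2 / 2))"
  have "f m \<le> f \<rho>"
  proof (rule DERIV_nonpos_imp_nonincreasing[OF assms(2)])
    fix t assume t: "\<rho> \<le> t" "t \<le> m"
    have e: "((\<lambda>x::real. exp (- x\<^sup>2 / 2)) has_real_derivative - (t * exp (- t\<^sup>2 / 2))) (at t)"
      by (auto intro!: derivative_eq_intros)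
    have "(cosh has_real_derivative sinh t) (at t)"
      by (rule derivative_eq_intros refl)+ simp
    from DERIV_mult[OF this e]
    have "(f has_real_derivative (sinh t - t * cosh t) * exp (- t\<^sup>2 / 2)) (at t)"
      unfolding f_def by (rule DERIV_cong) (simp add: algebra_simps)
    moreover have "(sinh t - t * cosh t) * exp (- t\<^sup>2 / 2) \<le> 0"
      using sinh_le_mult_cosh[of t] t assms by (simp add: mult_le_0_iff)
    ultimately show "\<exists>y. (f has_real_derivative y) (at t) \<and> y \<le> 0" by blast
  qed
  then have "f m * exp (m\<^sup>2 / 2) \<le> f \<rho> * exp (m\<^sup>2 / 2)" by simp
  then show ?thesis by (simp add: f_def mult.assoc exp_add[symmetric] diff_divide_distrib)
qed

text \<open>With \<open>m\<close> the mean and \<open>d\<close> the half-difference of the two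
  norms, the left side is \<open>2 * (cosh m * cosh d)\<close>, while smoothness reads
  \<open>m\<^sup>2 + d\<^sup>2 \<le> (norm x)\<^sup>2 + \<beta>\<^sup>2 * (norm
  y)\<^sup>2\<close>.\<close>

lemma cosh_norm_second_difference:
  fixes x y :: "'b::real_normed_vector"
  assumes "beta_smooth \<beta> TYPE('b)"
  shows "cosh (norm (x + y)) + cosh (norm (x - y)) \<le> 2 * cosh (norm x) * exp (\<beta>\<^sup>2 * (norm y)\<^sup>2 / 2)"
proof -
  define m d where md: "m = (norm (x + y) + norm (x - y)) / 2" "d = \<bar>norm (x + y) - norm (x - y)\<bar> / 2"
  have sq: "m\<^sup>2 + d\<^sup>2 = ((norm (x + y))\<^sup>2 + (norm (x - y))\<^sup>2) / 2"
    unfolding md by (simp add: power2_eq_square field_simps)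
  have eq: "cosh (norm (x + y)) + cosh (norm (x - y)) = 2 * (cosh m * cosh d)"
  proof -
    have "cosh \<bar>e\<bar> = cosh e" for e :: real by (simp add: abs_if)
    from this[of "(norm (x + y) - norm (x - y)) / 2"]
    have "cosh m * cosh d = cosh m * cosh ((norm (x + y) - norm (x - y)) / 2)"
      unfolding md by simp
    moreover have "cosh (m + e) + cosh (m - e) = 2 * (cosh m * cosh e)" for e
      by (simp add: cosh_add cosh_diff)
    moreover have "m + (norm (x + y) - norm (x - y)) / 2 = norm (x + y)"
      "m - (norm (x + y) - norm (x - y)) / 2 = norm (x - y)"
      unfolding md by (simp_all add: field_simps)
    ultimately show ?thesis by (metis (no_types))
  qed
  have le: "m\<^sup>2 + d\<^sup>2 \<le> (norm x)\<^sup>2 + \<beta>\<^sup>2 * (norm y)\<^sup>2"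
    unfolding sq using beta_smoothD[OF assms, of x y] by simp
  have "\<bar>norm (x + y) - norm (x - y)\<bar> \<le> norm ((x + y) - (x - y))" by (rule norm_triangle_ineq3)
  also have "(x + y) - (x - y) = 2 *\<^sub>R y" by (simp add: scaleR_2)
  finally have "d \<le> norm y" unfolding md by simp
  moreover have d0: "d \<ge> 0" unfolding md by simp
  ultimately have "d\<^sup>2 \<le> (norm y)\<^sup>2" by (simp add: power_mono)
  then have d: "d\<^sup>2 \<le> \<beta>\<^sup>2 * (norm y)\<^sup>2" using beta_smooth_norm_le[OF assms, of y] by simp
  have cd: "cosh d \<le> exp (d\<^sup>2 / 2)" using cosh_le_cosh_exp[of 0 d] d0 by simp
  have m0: "m \<ge> 0" unfolding md by simp
  have "cosh m * cosh d \<le> cosh (norm x) * exp (\<beta>\<^sup>2 * (norm y)\<^sup>2 / 2)"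
  \<comment> \<open>The Gaussian comparison goes only upwards from \<open>norm x\<close>. For
    smaller \<open>m\<close> the factor \<open>cosh m\<close> is harmless and \<open>cosh d\<close>
    is bounded alone, through \<open>d \<le> norm y\<close> and
    \<open>(norm y)\<^sup>2 \<le> \<beta>\<^sup>2 * (norm y)\<^sup>2\<close>.\<close>
  proof (cases "m \<le> norm x")
    case True
    then have "cosh m \<le> cosh (norm x)" using m0 by (simp add: cosh_real_nonneg_le_iff)
    moreover have "cosh d \<le> exp (\<beta>\<^sup>2 * (norm y)\<^sup>2 / 2)" using cd d by (smt (verit) exp_le_cancel_iff divide_right_mono)
    ultimately show ?thesis by (intro mult_mono) auto
  next
    case False
    then have "cosh m \<le> cosh (norm x) * exp ((m\<^sup>2 - (norm x)\<^sup>2) / 2)"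
      by (intro cosh_le_cosh_exp) auto
    then have "cosh m * cosh d \<le> (cosh (norm x) * exp ((m\<^sup>2 - (norm x)\<^sup>2) / 2)) * exp (d\<^sup>2 / 2)"
      using cd by (intro mult_mono) auto
    also have "\<dots> = cosh (norm x) * exp ((m\<^sup>2 + d\<^sup>2 - (norm x)\<^sup>2) / 2)"
      by (simp add: mult.assoc exp_add[symmetric] add_divide_distrib diff_divide_distrib)
    also have "\<dots> \<le> cosh (norm x) * exp (\<beta>\<^sup>2 * (norm y)\<^sup>2 / 2)"
      using le by (intro mult_left_mono) auto
    finally show ?thesis .
  qed
  then show ?thesis unfolding eq by simp
qed

text \<open>A continuous function whose symmetric second differences are eventually negative lies above its
  chords: otherwise it would have an interior local minimum relative to a chord.\<close>

lemma chord_le_of_second_difference: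
  fixes f :: "real \<Rightarrow> real"
  assumes cont: "continuous_on {0..1} f"
    and neg: "\<And>s. 0 < s \<Longrightarrow> s < 1 \<Longrightarrow> \<forall>\<^sub>F t in at_right 0. f (s + t) + f (s - t) - 2 * f s < 0"
    and s: "0 \<le> s" "s \<le> 1"
  shows "f 0 + s * (f 1 - f 0) \<le> f s"
proof (rule ccontr)
  assume not: "\<not> ?thesis"
  define g where "g = (\<lambda>s. f s - f 0 - s * (f 1 - f 0))"
  have "continuous_on {0..1} g" unfolding g_def by (intro continuous_intros cont)
  then obtain z where z: "z \<in> {0..1}" "\<And>t. t \<in> {0..1} \<Longrightarrow> g z \<le> g t"
    using continuous_attains_inf[of "{0..1::real}" g] by auto
  have "g s < 0" using not by (simp add: g_def)
  then have gz: "g z < 0" using z(2)[of s] s by auto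
  have "g 0 = 0" "g 1 = 0" by (auto simp: g_def)
  then have z01: "0 < z" "z < 1" using z(1) gz by (auto simp: less_le)
  have "\<forall>\<^sub>F t in at_right 0. t < z \<and> t < 1 - z \<and> t > 0"
    using z01 by (auto simp: eventually_at_right_field intro!: exI[of _ "min z (1 - z)"])
  with neg[OF z01] have "\<forall>\<^sub>F t in at_right (0::real). False"
  proof eventually_elim
    case (elim t)
    have "g z \<le> g (z + t)" "g z \<le> g (z - t)" using elim by (auto intro!: z)
    then show ?case using elim(1) by (simp add: g_def algebra_simps)
  qed
  then show False by simp
qed

lemma cosh_add_le_exp: "0 \<le> b \<Longrightarrow> cosh (a + b) \<le> cosh a * exp (b::real)"
proof -
  assume "0 \<le> b"
  then have "exp (- b) \<le> exp b" by simp
  then have "exp (- a) * exp (- b) \<le> exp (- a) * exp b" by simp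
  then show ?thesis by (simp add: cosh_field_def exp_add exp_diff exp_minus field_simps)
qed

lemma cosh_ge_one_plus: "1 + x\<^sup>2 / 2 \<le> cosh (x::real)"
proof -
  have "(\<lambda>n. (if even n then x ^ n /\<^sub>R fact n else 0)) sums cosh x"
    using cosh_converges[of x] by (simp add: if_distrib cong: if_cong)
  then have "(\<Sum>n<3. (if even n then x ^ n /\<^sub>R fact n else 0)) \<le> cosh x"
    by (intro sum_le_suminf[THEN order_trans]) (auto simp: sums_iff zero_le_even_power)
  then show ?thesis by (simp add: eval_nat_numeral)
qed

text \<open>Compare \<open>s \<mapsto> cosh (norm (x + s *\<^sub>R y))\<close> with a function whose second derivative dominates
  its second differences, so that the difference of the two is concave on \<open>[0, 1]\<close>.\<close>

lemma cosh_norm_add_le: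
  fixes x y :: "'b::real_normed_vector"
  assumes "beta_smooth \<beta> TYPE('b)"
  shows "cosh (norm (x + y)) \<le> cosh (norm x) + sinh (norm x) * norm_deriv x y
    + \<beta>\<^sup>2 * cosh (norm x) * (exp (norm y) - 1 - norm y)"
proof (cases "y = 0")
  case True
  then show ?thesis using norm_deriv_abs_le[of x 0] by simp
next
  case False
  \<comment> \<open>\<open>\<psi>\<close> vanishes to first order at 0 and has second derivative
    \<open>\<beta>\<^sup>2 * \<eta>\<^sup>2 * cosh (norm x) * exp (s * \<eta>)\<close>. This
    majorizes the curvature allowed for \<open>u\<close>, because
    \<open>u s \<le> cosh (norm x) * exp (s * \<eta>)\<close>.\<close>
  define \<eta> u \<psi> where defs: "\<eta> = norm y" "u = (\<lambda>s. cosh (norm (x + s *\<^sub>R y)))"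
    "\<psi> = (\<lambda>s. \<beta>\<^sup>2 * cosh (norm x) * (exp (s * \<eta>) - 1 - s * \<eta>))"
  have \<eta>: "\<eta> > 0" using False by (simp add: defs)
  have beta: "\<beta>\<^sup>2 > 0" using beta_smooth_norm_le[OF assms, of y] False
    by (cases "\<beta> = 0") auto
  have main: "u 1 - u 0 - \<psi> 1 - \<epsilon> \<le> sinh (norm x) * norm_deriv x y" if \<epsilon>: "\<epsilon> > 0" for \<epsilon>
  proof -
    \<comment> \<open>The second differences of \<open>u\<close> and \<open>\<psi>\<close> are
      compared only up to an error of order \<open>t ^ 4\<close>; the term
      \<open>\<epsilon> * s\<^sup>2\<close> outweighs that error for small \<open>t\<close> and
      makes the second differences of \<open>f\<close> strictly negative. At the end \<epsilon>
      tends to 0.\<close>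
    define f where "f = (\<lambda>s. u s - \<psi> s - \<epsilon> * s\<^sup>2)"
    have cont: "continuous_on {0..1} f" unfolding f_def defs
      by (intro continuous_intros continuous_on_cosh)
    have chord: "f 0 + s * (f 1 - f 0) \<le> f s" if "0 \<le> s" "s \<le> 1" for s
    proof (rule chord_le_of_second_difference[OF cont _ that])
      fix s :: real assume s: "0 < s" "s < 1"
      define c where "c = 2 * cosh (norm x) * exp (s * \<eta>)"
      have c: "c > 0" by (simp add: c_def)
      have "\<forall>\<^sub>F t in at_right 0. c * ((exp (\<beta>\<^sup>2 * \<eta>\<^sup>2 / 2 * t\<^sup>2) - 1) - \<beta>\<^sup>2 * \<eta>\<^sup>2 / 2 * t\<^sup>2) - 2 * \<epsilon> * t\<^sup>2 < 0"
        using c \<epsilon> beta \<eta> by real_asymp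
      then have "\<forall>\<^sub>F t in at_right 0. t > 0 \<and> c * ((exp (\<beta>\<^sup>2 * \<eta>\<^sup>2 / 2 * t\<^sup>2) - 1) - \<beta>\<^sup>2 * \<eta>\<^sup>2 / 2 * t\<^sup>2) - 2 * \<epsilon> * t\<^sup>2 < 0"
        by (intro eventually_conj eventually_at_right_less)
      then show "\<forall>\<^sub>F t in at_right 0. f (s + t) + f (s - t) - 2 * f s < 0"
      proof eventually_elim
        case (elim t)
        have "u (s + t) + u (s - t) \<le> 2 * u s * exp (\<beta>\<^sup>2 * \<eta>\<^sup>2 / 2 * t\<^sup>2)"
          using cosh_norm_second_difference[OF assms, of "x + s *\<^sub>R y" "t *\<^sub>R y"]
          by (simp add: defs algebra_simps power_mult_distrib)
        then have 1: "u (s + t) + u (s - t) - 2 * u s \<le> 2 * u s * (exp (\<beta>\<^sup>2 * \<eta>\<^sup>2 / 2 * t\<^sup>2) - 1)"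
          by (simp add: algebra_simps)
        have "norm (x + s *\<^sub>R y) \<le> norm x + s * \<eta>"
          using norm_triangle_ineq[of x "s *\<^sub>R y"] s by (simp add: defs)
        then have "u s \<le> cosh (norm x + s * \<eta>)"
          unfolding defs using s by (subst cosh_real_nonneg_le_iff) auto
        also have "\<dots> \<le> cosh (norm x) * exp (s * \<eta>)"
          using s \<eta> by (intro cosh_add_le_exp) simp
        finally have "2 * u s \<le> c" by (simp add: c_def)
        then have 2: "2 * u s * (exp (\<beta>\<^sup>2 * \<eta>\<^sup>2 / 2 * t\<^sup>2) - 1) \<le> c * (exp (\<beta>\<^sup>2 * \<eta>\<^sup>2 / 2 * t\<^sup>2) - 1)"
          by (intro mult_right_mono) auto
        have "\<psi> (s + t) + \<psi> (s - t) - 2 * \<psi> s = \<beta>\<^sup>2 * c * (cosh (t * \<eta>) - 1)"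
          by (simp add: defs c_def cosh_field_def ring_distribs exp_add exp_diff exp_minus field_simps)
        moreover have "\<beta>\<^sup>2 * c * (cosh (t * \<eta>) - 1) \<ge> \<beta>\<^sup>2 * c * ((t * \<eta>)\<^sup>2 / 2)"
          using c cosh_ge_one_plus[of "t * \<eta>"] by (intro mult_left_mono) auto
        ultimately have 3: "\<psi> (s + t) + \<psi> (s - t) - 2 * \<psi> s \<ge> c * (\<beta>\<^sup>2 * \<eta>\<^sup>2 / 2 * t\<^sup>2)"
          by (simp add: power_mult_distrib algebra_simps)
        have "\<epsilon> * (s + t)\<^sup>2 + \<epsilon> * (s - t)\<^sup>2 - 2 * (\<epsilon> * s\<^sup>2) = 2 * \<epsilon> * t\<^sup>2"
          by (simp add: power2_eq_square algebra_simps)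
        then show ?case using 1 2 3 elim unfolding f_def by (simp add: algebra_simps)
      qed
    qed
    have u': "((\<lambda>s. (u s - u 0) / s) \<longlongrightarrow> sinh (norm x) * norm_deriv x y) (at_right 0)"
    \<comment> \<open>The norm is not differentiable at 0, but \<open>cosh (\<eta> * s)\<close> is
      even in \<open>s\<close>, so its derivative there is 0, in agreement with
      \<open>sinh 0 = 0\<close>.\<close>
    proof (cases "x = 0")
      case True
      have "((\<lambda>s. (cosh (\<eta> * s) - 1) / s) \<longlongrightarrow> 0) (at_right 0)"
        using \<eta> by real_asymp
      moreover have "\<forall>\<^sub>F s in at_right 0. (cosh (\<eta> * s) - 1) / s = (u s - u 0) / s"
        using True by (auto simp: eventually_at_right_field defs mult.commute intro!: exI[of _ 1])
      ultimately show ?thesis using True by (auto intro: Lim_transform_eventually)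
    next
      case False
      have N: "((\<lambda>s. norm (x + s *\<^sub>R y)) has_real_derivative norm_deriv x y) (at 0 within {0<..})"
        using norm_deriv_tendsto[OF False, of y] by (simp add: has_field_derivative_iff)
      have "(cosh has_real_derivative sinh (norm x)) (at (norm (x + 0 *\<^sub>R y)))"
        by (auto intro!: derivative_eq_intros)
      from DERIV_chain2[OF this N] show ?thesis
        by (simp add: has_field_derivative_iff defs)
    qed
    have "((\<lambda>s. \<psi> s / s + \<epsilon> * s) \<longlongrightarrow> 0) (at_right 0)"
      unfolding defs(3) using \<eta> by real_asymp
    from tendsto_diff[OF u' this]
    have "((\<lambda>s. (u s - u 0) / s - (\<psi> s / s + \<epsilon> * s)) \<longlongrightarrow> sinh (norm x) * norm_deriv x y) (at_right 0)"
      by simp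
    moreover have "f 1 - f 0 \<le> (u s - u 0) / s - (\<psi> s / s + \<epsilon> * s)" if "0 < s" "s < 1" for s
    proof -
      have "f 1 - f 0 \<le> (f s - f 0) / s" using chord[of s] that by (simp add: field_simps)
      also have "\<dots> = (u s - u 0) / s - (\<psi> s / s + \<epsilon> * s)"
        using that by (simp add: f_def defs(3) field_simps power2_eq_square)
      finally show ?thesis .
    qed
    then have "\<forall>\<^sub>F s in at_right 0. f 1 - f 0 \<le> (u s - u 0) / s - (\<psi> s / s + \<epsilon> * s)"
      by (auto simp: eventually_at_right_field intro!: exI[of _ 1])
    ultimately have "f 1 - f 0 \<le> sinh (norm x) * norm_deriv x y"
      by (rule tendsto_lowerbound) simp
    then show ?thesis by (simp add: f_def defs(3))
  qed
  have "u 1 - u 0 - \<psi> 1 \<le> sinh (norm x) * norm_deriv x y"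
    by (rule field_le_epsilon) (use main in force)
  then show ?thesis by (simp add: defs)
qed

text \<open>Termwise in the power series, \<open>u ^ (n + 2) \<le> u\<^sup>2 * b ^ n\<close>. For
  \<open>b = 2 / \<beta>\<close> the constant on the right is the one in
  \<open>C_space\<close>.\<close>

lemma exp_minus_linear_le:
  fixes u b :: real
  assumes "0 \<le> u" "u \<le> b" "0 < b"
  shows "exp u - 1 - u \<le> u\<^sup>2 * ((exp b - b - 1) / b\<^sup>2)"
proof -
  have ser: "(\<lambda>n. x ^ (n + 2) / fact (n + 2)) sums (exp x - 1 - x)" for x :: real
  proof -
    have "(\<lambda>n. x ^ n / fact n) sums exp x"
      using exp_converges[of x] by (simp add: divide_inverse mult.commute)
    from sums_split_initial_segment[OF this, of 2] show ?thesis
      by (simp add: eval_nat_numeral diff_diff_eq)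
  qed
  have 1: "(\<lambda>n. u\<^sup>2 / b\<^sup>2 * (b ^ (n + 2) / fact (n + 2))) sums (u\<^sup>2 / b\<^sup>2 * (exp b - 1 - b))"
    by (intro sums_mult ser)
  have "u ^ (n + 2) / fact (n + 2) \<le> u\<^sup>2 / b\<^sup>2 * (b ^ (n + 2) / fact (n + 2))" for n
  proof -
    have "u ^ (n + 2) \<le> u\<^sup>2 * b ^ n"
      unfolding power_add mult.commute[of "u ^ n"] using assms by (intro mult_left_mono power_mono) auto
    also have "\<dots> = u\<^sup>2 / b\<^sup>2 * b ^ (n + 2)" using assms by (simp add: power_add power2_eq_square)
    finally have "u ^ (n + 2) / fact (n + 2) \<le> u\<^sup>2 / b\<^sup>2 * b ^ (n + 2) / fact (n + 2)"
      by (rule divide_right_mono) simp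
    then show ?thesis by (metis times_divide_eq_right)
  qed
  then have "exp u - 1 - u \<le> u\<^sup>2 / b\<^sup>2 * (exp b - 1 - b)"
    by (rule sums_le[OF _ ser[of u] 1])
  then show ?thesis by (simp add: algebra_simps)
qed

subsection \<open>Banach-valued conditional expectations\<close>

text \<open>A relation to one version \<open>D\<close> rather than an operator, so that a version
  may be replaced by a better one. Set integrals are the form in which the theorem states the
  conditional mean of \<open>X\<close>.\<close>

definition is_cond_exp ::
    "'a measure \<Rightarrow> 'a measure \<Rightarrow> ('a \<Rightarrow> 'b::{banach, second_countable_topology}) \<Rightarrow> ('a \<Rightarrow> 'b) \<Rightarrow> bool" where
  "is_cond_exp M F f D \<longleftrightarrow> integrable M f \<and> integrable M D \<and> D \<in> borel_measurable F \<and>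
     (\<forall>A\<in>sets F. (\<integral>x\<in>A. f x \<partial>M) = (\<integral>x\<in>A. D x \<partial>M))"

text \<open>The weight \<open>w\<close> has to vanish with \<open>S\<close> because \<open>norm_deriv\<close> is discontinuous in its base point at 0.\<close>

lemma
  fixes g S :: "'a \<Rightarrow> 'b::{banach, second_countable_topology}" and w :: "'a \<Rightarrow> real"
  assumes smooth: "beta_smooth \<beta> TYPE('b)"
    and sub: "subalgebra M F"
    and g: "integrable M g"
    and S: "S \<in> borel_measurable F"
    and w: "w \<in> borel_measurable F" "\<And>x. x \<in> space M \<Longrightarrow> \<bar>w x\<bar> \<le> K"
    and w0: "\<And>x. x \<in> space M \<Longrightarrow> S x = 0 \<Longrightarrow> w x = 0"
  shows integrable_norm_deriv: "integrable M (\<lambda>x. w x * norm_deriv (S x) (g x))"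
    and integral_norm_deriv_eq_0:
      "(\<And>A. A \<in> sets F \<Longrightarrow> (\<integral>x\<in>A. g x \<partial>M) = 0) \<Longrightarrow> (\<integral>x. w x * norm_deriv (S x) (g x) \<partial>M) = 0"
proof -
  have sp: "space F = space M" and sets: "\<And>A. A \<in> sets F \<Longrightarrow> A \<in> sets M"
    using sub by (auto simp: subalgebra_def)
  obtain s where s: "\<And>i. simple_function F (s i)" "\<And>x. x \<in> space M \<Longrightarrow> (\<lambda>i. s i x) \<longlonglongrightarrow> S x"
    using borel_measurable_implies_sequence_metric[OF S] sp by metis
  obtain u where u: "\<And>i. simple_function F (u i)" "\<And>x. x \<in> space M \<Longrightarrow> (\<lambda>i. u i x) \<longlonglongrightarrow> w x"
      "\<And>i x. x \<in> space M \<Longrightarrow> dist (u i x) 0 \<le> 2 * dist (w x) 0"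
    using borel_measurable_implies_sequence_metric[OF w(1), of 0] sp by metis
  \<comment> \<open>For simple approximations of weight and base point, the pairing is, on each of
    finitely many pieces in \<open>F\<close>, a constant times one fixed bounded linear functional.
    Such functionals commute with the Bochner integral, and measurability of the pairing itself
    follows as that of a limit.\<close>
  define h where "h = (\<lambda>i x. u i x * norm_deriv (s i x) (g x))"
  define R where "R = (\<lambda>i. (\<lambda>x. (u i x, s i x)) ` space F)"
  define A where "A = (\<lambda>i z. {x \<in> space F. (u i x, s i x) = z})"
  have sim: "simple_function F (\<lambda>x. (u i x, s i x))" for i
    by (intro simple_function_Pair s u)
  have R: "finite (R i)" for i using simple_functionD(1)[OF sim[of i]] by (simp add: R_def)
  have A: "A i z \<in> sets F" for i z
    using simple_functionD(2)[OF sim[of i], of "{z}"] by (simp add: A_def vimage_def Int_def conj_commute)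
  note bl = bounded_linear_norm_deriv[OF smooth]
  have h_eq: "h i x = (\<Sum>z\<in>R i. fst z * norm_deriv (snd z) (indicator (A i z) x *\<^sub>R g x))" if "x \<in> space M" for i x
  proof -
    have "(\<Sum>z\<in>R i. fst z * norm_deriv (snd z) (indicator (A i z) x *\<^sub>R g x))
        = (\<Sum>z\<in>R i. if z = (u i x, s i x) then h i x else 0)"
      using that sp by (intro sum.cong) (auto simp: A_def h_def indicator_def linear_simps[OF bl])
    also have "\<dots> = h i x" using that R sp by (auto simp: R_def sum.delta)
    finally show ?thesis by simp
  qed
  have gA: "integrable M (\<lambda>x. indicator (A i z) x *\<^sub>R g x)" for i z
    by (intro integrable_mult_indicator sets A g)
  have int_z: "integrable M (\<lambda>x. fst z * norm_deriv (snd z) (indicator (A i z) x *\<^sub>R g x))" for i z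
    by (intro integrable_mult_right integrable_bounded_linear[OF bl] gA)
  have h_int: "integrable M (h i)" for i
    using int_z by (subst Bochner_Integration.integrable_cong[OF refl h_eq]) auto
  have h_lim: "(\<lambda>i. h i x) \<longlonglongrightarrow> w x * norm_deriv (S x) (g x)" if x: "x \<in> space M" for x
  proof (cases "S x = 0")
    case True
    then have "(\<lambda>i. \<bar>u i x\<bar> * norm (g x)) \<longlonglongrightarrow> 0"
      using tendsto_mult_left_zero[OF tendsto_rabs_zero[of "\<lambda>i. u i x"]] u(2)[OF x] w0[OF x] by simp
    then have "(\<lambda>i. h i x) \<longlonglongrightarrow> 0"
      by (rule Lim_null_comparison[rotated])
         (auto simp: h_def abs_mult intro!: always_eventually mult_left_mono norm_deriv_abs_le)
    then show ?thesis using True w0[OF x] by simp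
  next
    case False
    then show ?thesis unfolding h_def
      by (intro tendsto_mult u x norm_deriv_continuous_base[OF smooth] s) auto
  qed
  have h_bound: "norm (h i x) \<le> 2 * K * norm (g x)" if x: "x \<in> space M" for i x
  proof -
    have "\<bar>u i x\<bar> \<le> 2 * K" using u(3)[OF x, of i] w(2)[OF x] by simp
    then show ?thesis unfolding h_def real_norm_def abs_mult
      by (intro mult_mono norm_deriv_abs_le) auto
  qed
  have [measurable]: "h i \<in> borel_measurable M" for i using h_int by auto
  have meas: "(\<lambda>x. w x * norm_deriv (S x) (g x)) \<in> borel_measurable M"
    by (rule borel_measurable_LIMSEQ_real[OF h_lim]) auto
  have dom: "integrable M (\<lambda>x. 2 * K * norm (g x))" using g by auto
  have conv: "AE x in M. (\<lambda>i. h i x) \<longlonglongrightarrow> w x * norm_deriv (S x) (g x)"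
    "\<And>i. AE x in M. norm (h i x) \<le> 2 * K * norm (g x)"
    using h_lim h_bound by auto
  show "integrable M (\<lambda>x. w x * norm_deriv (S x) (g x))"
    by (rule integrable_dominated_convergence[OF meas _ dom conv]) auto
  assume zero: "\<And>A. A \<in> sets F \<Longrightarrow> (\<integral>x\<in>A. g x \<partial>M) = 0"
  have "integral\<^sup>L M (h i) = 0" for i
  proof -
    have "integral\<^sup>L M (h i) = (\<integral>x. (\<Sum>z\<in>R i. fst z * norm_deriv (snd z) (indicator (A i z) x *\<^sub>R g x)) \<partial>M)"
      by (intro Bochner_Integration.integral_cong refl h_eq)
    also have "\<dots> = (\<Sum>z\<in>R i. fst z * norm_deriv (snd z) (\<integral>x. indicator (A i z) x *\<^sub>R g x \<partial>M))"
      using int_z by (simp add: integral_bounded_linear[OF bl gA])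
    also have "\<dots> = 0"
      using zero[OF A] by (simp add: set_lebesgue_integral_def linear_simps[OF bl])
    finally show ?thesis .
  qed
  moreover have "(\<lambda>i. integral\<^sup>L M (h i)) \<longlonglongrightarrow> (\<integral>x. w x * norm_deriv (S x) (g x) \<partial>M)"
    by (rule integral_dominated_convergence[OF meas _ dom conv]) auto
  ultimately show "(\<integral>x. w x * norm_deriv (S x) (g x) \<partial>M) = 0"
    by (simp add: LIMSEQ_const_iff)
qed

text \<open>This is the tower property for a pairing with an \<open>F\<close>-measurable functional:
  \<open>f - D\<close> has vanishing integral over every set of \<open>F\<close>, so its weighted
  pairing integrates to 0.\<close>

lemma is_cond_exp_integral_norm_deriv:
  fixes f S D :: "'a \<Rightarrow> 'b::{banach, second_countable_topology}" and w :: "'a \<Rightarrow> real"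
  assumes smooth: "beta_smooth \<beta> TYPE('b)"
    and sub: "subalgebra M F"
    and ce: "is_cond_exp M F f D"
    and S: "S \<in> borel_measurable F"
    and w: "w \<in> borel_measurable F" "\<And>x. x \<in> space M \<Longrightarrow> \<bar>w x\<bar> \<le> K"
    and w0: "\<And>x. x \<in> space M \<Longrightarrow> S x = 0 \<Longrightarrow> w x = 0"
  shows "(\<integral>x. w x * norm_deriv (S x) (f x) \<partial>M) = (\<integral>x. w x * norm_deriv (S x) (D x) \<partial>M)"
proof -
  have f: "integrable M f" and D: "integrable M D"
    and eq: "\<And>A. A \<in> sets F \<Longrightarrow> (\<integral>x\<in>A. f x \<partial>M) = (\<integral>x\<in>A. D x \<partial>M)"
    using ce by (auto simp: is_cond_exp_def)
  have "(\<integral>x. w x * norm_deriv (S x) (f x - D x) \<partial>M) = 0"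
  proof (rule integral_norm_deriv_eq_0[OF smooth sub _ S w w0])
    fix A assume A: "A \<in> sets F"
    then have "A \<in> sets M" using sub by (auto simp: subalgebra_def)
    then have "set_integrable M A f" "set_integrable M A D"
      using f D by (auto simp: set_integrable_def intro: integrable_mult_indicator)
    then show "(\<integral>x\<in>A. f x - D x \<partial>M) = 0" using eq[OF A] by (simp add: set_integral_diff)
  qed (use f D in auto)
  moreover have "(\<lambda>x. w x * norm_deriv (S x) (f x - D x))
      = (\<lambda>x. w x * norm_deriv (S x) (f x) - w x * norm_deriv (S x) (D x))"
    by (simp add: linear_simps[OF bounded_linear_norm_deriv[OF smooth]] algebra_simps)
  moreover have "integrable M (\<lambda>x. w x * norm_deriv (S x) (f x))"
    by (rule integrable_norm_deriv[OF smooth sub f S w w0])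
  moreover have "integrable M (\<lambda>x. w x * norm_deriv (S x) (D x))"
    by (rule integrable_norm_deriv[OF smooth sub D S w w0])
  ultimately show ?thesis by simp
qed

text \<open>Conditional Jensen inequality for the norm: at base point \<open>D x\<close> the pairing
  of \<open>D x\<close> is its norm, that of \<open>f x\<close> at most \<open>norm (f x)\<close>.
  Cutting the weight down to \<open>D x \<noteq> 0\<close> makes it admissible.\<close>

lemma is_cond_exp_norm_le:
  fixes f D :: "'a \<Rightarrow> 'b::{banach, second_countable_topology}"
  assumes smooth: "beta_smooth \<beta> TYPE('b)"
    and sub: "subalgebra M F"
    and ce: "is_cond_exp M F f D"
    and A: "A \<in> sets F"
  shows "(\<integral>x\<in>A. norm (D x) \<partial>M) \<le> (\<integral>x\<in>A. norm (f x) \<partial>M)"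
proof -
  have f: "integrable M f" and D[measurable]: "D \<in> borel_measurable F" and AM: "A \<in> sets M"
    using ce A sub by (auto simp: is_cond_exp_def subalgebra_def)
  define w :: "'a \<Rightarrow> real" where "w = indicator (A \<inter> {x \<in> space F. D x \<noteq> 0})"
  have w: "w \<in> borel_measurable F" unfolding w_def using A by measurable
  have prem: "\<And>x. x \<in> space M \<Longrightarrow> \<bar>w x\<bar> \<le> 1" "\<And>x. x \<in> space M \<Longrightarrow> D x = 0 \<Longrightarrow> w x = 0"
    by (auto simp: w_def indicator_def)
  have "(\<integral>x\<in>A. norm (D x) \<partial>M) = (\<integral>x. w x * norm_deriv (D x) (D x) \<partial>M)"
    unfolding set_lebesgue_integral_def
    using sub by (intro Bochner_Integration.integral_cong) (auto simp: w_def indicator_def norm_deriv_self subalgebra_def)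
  also have "\<dots> = (\<integral>x. w x * norm_deriv (D x) (f x) \<partial>M)"
    by (rule is_cond_exp_integral_norm_deriv[OF smooth sub ce D w prem, symmetric])
  also have "\<dots> \<le> (\<integral>x\<in>A. norm (f x) \<partial>M)"
    unfolding set_lebesgue_integral_def
  proof (rule integral_mono)
    show "integrable M (\<lambda>x. w x * norm_deriv (D x) (f x))"
      by (rule integrable_norm_deriv[OF smooth sub f D w prem])
    show "integrable M (\<lambda>x. indicat_real A x *\<^sub>R norm (f x))"
      using f AM by (intro integrable_mult_indicator) auto
    show "w x * norm_deriv (D x) (f x) \<le> indicat_real A x *\<^sub>R norm (f x)" for x
      using norm_deriv_abs_le[of "D x" "f x"] by (auto simp: w_def indicator_def)
  qed
  finally show ?thesis .
qed

lemma is_cond_exp_diff: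
  assumes sub: "subalgebra M F" and "is_cond_exp M F f D" "is_cond_exp M F g E"
  shows "is_cond_exp M F (\<lambda>x. f x - g x) (\<lambda>x. D x - E x)"
proof -
  have "set_integrable M A h" if "A \<in> sets F" "integrable M h" for A and h :: "'a \<Rightarrow> 'b"
    using that sub by (auto simp: set_integrable_def subalgebra_def intro: integrable_mult_indicator)
  then show ?thesis using assms(2,3) by (auto simp: is_cond_exp_def set_integral_diff)
qed

lemma AE_summable_norm:
  fixes f :: "nat \<Rightarrow> 'a \<Rightarrow> 'b::{banach, second_countable_topology}"
  assumes f: "\<And>i. integrable M (f i)" and s: "summable (\<lambda>i. \<integral>x. norm (f i x) \<partial>M)"
  shows "AE x in M. summable (\<lambda>i. norm (f i x))"
proof -
  have [measurable]: "f i \<in> borel_measurable M" for i using f by auto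
  have "(\<integral>\<^sup>+x. (\<Sum>i. ennreal (norm (f i x))) \<partial>M) = (\<Sum>i. \<integral>\<^sup>+x. ennreal (norm (f i x)) \<partial>M)"
    by (rule nn_integral_suminf) auto
  also have "\<dots> = (\<Sum>i. ennreal (\<integral>x. norm (f i x) \<partial>M))"
    using f by (intro suminf_cong nn_integral_eq_integral) auto
  also have "\<dots> \<noteq> \<infinity>" using s by (simp add: ennreal_suminf_neq_top)
  finally have "AE x in M. (\<Sum>i. ennreal (norm (f i x))) \<noteq> \<infinity>"
    by (intro nn_integral_PInf_AE) auto
  then show ?thesis by eventually_elim (auto intro: summable_suminf_not_top)
qed

text \<open>Real conditional expectations settle indicators times a vector. The passage to limits
  rests on the L1 contraction \<open>is_cond_exp_norm_le\<close>, which is where smoothness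
  enters.\<close>

lemma is_cond_exp_exists:
  fixes f :: "'a \<Rightarrow> 'b::{banach, second_countable_topology}"
  assumes smooth: "beta_smooth \<beta> TYPE('b)"
    and sfs: "sigma_finite_subalgebra M F"
    and f: "integrable M f"
  shows "\<exists>D. is_cond_exp M F f D"
proof -
  interpret sigma_finite_subalgebra M F by fact
  note sub = subalg
  have si: "set_integrable M A h" if "A \<in> sets F" "integrable M h" for A and h :: "'a \<Rightarrow> 'b"
    using that sub by (auto simp: set_integrable_def subalgebra_def intro: integrable_mult_indicator)
  show ?thesis using f
  proof (induction rule: integrable_induct)
    case (base A c)
    have iA: "integrable M (indicat_real A)" using base by auto
    define D where "D = (\<lambda>x. real_cond_exp M F (indicator A) x *\<^sub>R c)"
    have rc: "integrable M (real_cond_exp M F (indicator A))" by (rule real_cond_exp_int[OF iA])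
    have "(\<integral>x\<in>B. indicat_real A x *\<^sub>R c \<partial>M) = (\<integral>x\<in>B. D x \<partial>M)" if B: "B \<in> sets F" for B
    proof -
      have BM: "B \<in> sets M" using B sub by (auto simp: subalgebra_def)
      have "(\<integral>x\<in>B. indicat_real A x *\<^sub>R c \<partial>M) = (\<integral>x\<in>B. indicat_real A x \<partial>M) *\<^sub>R c"
        unfolding set_lebesgue_integral_def using integrable_mult_indicator[OF BM iA]
        by (subst integral_scaleR_left[symmetric]) auto
      also have "\<dots> = (\<integral>x\<in>B. real_cond_exp M F (indicator A) x \<partial>M) *\<^sub>R c"
        using real_cond_exp_intA[OF iA B] by simp
      also have "\<dots> = (\<integral>x\<in>B. D x \<partial>M)"
        unfolding set_lebesgue_integral_def D_def using integrable_mult_indicator[OF BM rc]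
        by (subst integral_scaleR_left[symmetric]) auto
      finally show ?thesis .
    qed
    then have "is_cond_exp M F (\<lambda>x. indicat_real A x *\<^sub>R c) D"
      using iA rc unfolding is_cond_exp_def D_def by auto
    then show ?case by blast
  next
    case (add f g)
    then obtain D E where "is_cond_exp M F f D" "is_cond_exp M F g E" by blast
    then have "is_cond_exp M F (\<lambda>x. f x + g x) (\<lambda>x. D x + E x)"
      using si by (auto simp: is_cond_exp_def set_integral_add)
    then show ?case by blast
  next
    case (lim f s)
    note [measurable] = borel_measurable_integrable[OF lim.hyps(1)] borel_measurable_integrable[OF lim.hyps(4)]
    have s_lim: "(\<lambda>i. \<integral>x. norm (s i x - f x) \<partial>M) \<longlonglongrightarrow> (\<integral>x. 0 \<partial>M)"
    proof (rule integral_dominated_convergence[where w = "\<lambda>x. 3 * norm (f x)"])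
      show "AE x in M. (\<lambda>i. norm (s i x - f x)) \<longlonglongrightarrow> 0"
        using lim.hyps(2) by (auto simp: tendsto_norm_zero_iff LIM_zero_iff)
      show "AE x in M. norm (norm (s i x - f x)) \<le> 3 * norm (f x)" for i
      proof (rule AE_I2)
        fix x assume "x \<in> space M"
        then show "norm (norm (s i x - f x)) \<le> 3 * norm (f x)"
          using lim.hyps(3)[of x i] norm_triangle_ineq4[of "s i x" "f x"] by simp
      qed
    qed (use lim.hyps in auto)
    \<comment> \<open>A geometric rate makes the successive differences of the conditional
      expectations summable in L1, hence summable almost everywhere with an integrable
      majorant.\<close>
    have "\<exists>i. (\<integral>x. norm (s i x - f x) \<partial>M) < (1/2) ^ k" for k
      using eventually_happens[OF order_tendstoD(2)[OF s_lim, of "(1/2) ^ k"]] by simp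
    then obtain r where r: "\<And>k. (\<integral>x. norm (s (r k) x - f x) \<partial>M) < (1/2) ^ k" by metis
    obtain D where D: "\<And>i. is_cond_exp M F (s i) (D i)" using lim.IH by metis
    define E where "E = (\<lambda>k. D (r k))"
    have E_int: "integrable M (E k)" and E_meas[measurable]: "E k \<in> borel_measurable F" for k
      using D by (auto simp: E_def is_cond_exp_def)
    have [measurable]: "E k \<in> borel_measurable M" for k using E_int by auto
    have E_diff: "(\<integral>x. norm (E (Suc k) x - E k x) \<partial>M) \<le> 2 * (1/2) ^ k" for k
    proof -
      have "(\<integral>x\<in>space F. norm (E (Suc k) x - E k x) \<partial>M) \<le> (\<integral>x\<in>space F. norm (s (r (Suc k)) x - s (r k) x) \<partial>M)"
        by (rule is_cond_exp_norm_le[OF smooth sub]) (auto simp: E_def intro!: is_cond_exp_diff sub D)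
      then have "(\<integral>x. norm (E (Suc k) x - E k x) \<partial>M) \<le> (\<integral>x. norm (s (r (Suc k)) x - s (r k) x) \<partial>M)"
        using sub by (simp add: subalgebra_def set_integral_space lim.hyps E_int)
      also have "\<dots> \<le> (\<integral>x. norm (s (r (Suc k)) x - f x) + norm (s (r k) x - f x) \<partial>M)"
      proof (rule integral_mono)
        show "norm (s (r (Suc k)) x - s (r k) x) \<le> norm (s (r (Suc k)) x - f x) + norm (s (r k) x - f x)" for x
          using norm_triangle_ineq4[of "s (r (Suc k)) x - f x" "s (r k) x - f x"] by simp
      qed (use lim.hyps in auto)
      also have "\<dots> = (\<integral>x. norm (s (r (Suc k)) x - f x) \<partial>M) + (\<integral>x. norm (s (r k) x - f x) \<partial>M)"
        using lim.hyps by (intro Bochner_Integration.integral_add) auto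
      also have "\<dots> \<le> (1/2) ^ Suc k + (1/2) ^ k" using r[of k] r[of "Suc k"] by simp
      also have "\<dots> \<le> 2 * (1/2) ^ k" by simp
      finally show ?thesis .
    qed
    define \<Delta> where "\<Delta> = (\<lambda>k x. E (Suc k) x - E k x)"
    have \<Delta>_int: "integrable M (\<Delta> k)" for k using E_int by (simp add: \<Delta>_def)
    have \<Delta>_sum: "summable (\<lambda>k. \<integral>x. norm (\<Delta> k x) \<partial>M)"
      by (rule summable_comparison_test'[where g = "\<lambda>k. 2 * (1/2) ^ k" and N = 0])
         (use E_diff in \<open>auto simp: \<Delta>_def intro!: summable_mult\<close>)
    have AE_sum: "AE x in M. summable (\<lambda>k. norm (\<Delta> k x))"
      by (rule AE_summable_norm[OF \<Delta>_int \<Delta>_sum])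
    \<comment> \<open>Taken at every point, so that \<open>L\<close> is \<open>F\<close>-measurable;
      it is the limit of the sequence only off a null set.\<close>
    define L where "L = (\<lambda>x. lim (\<lambda>k. E k x))"
    have L_meas: "L \<in> borel_measurable F" unfolding L_def by measurable
    define W where "W = (\<lambda>x. norm (E 0 x) + (\<Sum>k. norm (\<Delta> k x)))"
    have W_int: "integrable M W" unfolding W_def
      using E_int \<Delta>_int \<Delta>_sum AE_sum by (intro Bochner_Integration.integrable_add integrable_suminf) auto
    have E_eq: "E k x = E 0 x + (\<Sum>i<k. \<Delta> i x)" for k x
      unfolding \<Delta>_def using sum_lessThan_telescope[of "\<lambda>k. E k x" k] by simp
    have lim_E: "AE x in M. (\<lambda>k. E k x) \<longlonglongrightarrow> L x"
      using AE_sum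
    proof eventually_elim
      case (elim x)
      then have "(\<lambda>k. \<Sum>i<k. \<Delta> i x) \<longlonglongrightarrow> (\<Sum>i. \<Delta> i x)"
        by (rule summable_LIMSEQ[OF summable_norm_cancel])
      from tendsto_add[OF tendsto_const[of "E 0 x"] this] have "convergent (\<lambda>k. E k x)"
        unfolding E_eq[symmetric] by (rule convergentI)
      then show ?case unfolding L_def by (simp only: convergent_LIMSEQ_iff)
    qed
    have bound_E: "AE x in M. norm (E k x) \<le> W x" for k
      using AE_sum
    proof eventually_elim
      case (elim x)
      have "norm (E k x) \<le> norm (E 0 x) + (\<Sum>i<k. norm (\<Delta> i x))"
        unfolding E_eq[of k] by (intro norm_triangle_le add_left_mono norm_sum)
      also have "(\<Sum>i<k. norm (\<Delta> i x)) \<le> (\<Sum>i. norm (\<Delta> i x))"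
        using elim by (intro sum_le_suminf) auto
      finally show ?case by (simp add: W_def)
    qed
    have [measurable]: "L \<in> borel_measurable M" by (rule measurable_from_subalg[OF sub L_meas])
    have L_int: "integrable M L"
      by (rule integrable_dominated_convergence[OF _ _ W_int lim_E bound_E]) auto
    have "(\<integral>x\<in>A. f x \<partial>M) = (\<integral>x\<in>A. L x \<partial>M)" if A: "A \<in> sets F" for A
    proof (rule LIMSEQ_unique)
      have [measurable]: "A \<in> sets M" using A sub by (auto simp: subalgebra_def)
      show "(\<lambda>k. \<integral>x\<in>A. E k x \<partial>M) \<longlonglongrightarrow> (\<integral>x\<in>A. L x \<partial>M)"
        unfolding set_lebesgue_integral_def
      proof (rule integral_dominated_convergence[OF _ _ W_int])
        show "AE x in M. (\<lambda>k. indicat_real A x *\<^sub>R E k x) \<longlonglongrightarrow> indicat_real A x *\<^sub>R L x"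
          using lim_E by eventually_elim (intro tendsto_intros)
        show "AE x in M. norm (indicat_real A x *\<^sub>R E k x) \<le> W x" for k
          using bound_E[of k] by eventually_elim (auto simp: indicator_def intro: order_trans[OF norm_ge_zero])
      qed measurable
      have le: "norm ((\<integral>x\<in>A. E k x \<partial>M) - (\<integral>x\<in>A. f x \<partial>M)) \<le> (1/2) ^ k" for k
      proof -
        have "(\<integral>x\<in>A. E k x \<partial>M) = (\<integral>x\<in>A. s (r k) x \<partial>M)"
          using D[of "r k"] A by (simp add: is_cond_exp_def E_def)
        then have "(\<integral>x\<in>A. E k x \<partial>M) - (\<integral>x\<in>A. f x \<partial>M) = (\<integral>x\<in>A. s (r k) x - f x \<partial>M)"
          using si[OF A] lim by (simp add: set_integral_diff)
        also have "norm \<dots> \<le> (\<integral>x. norm (indicat_real A x *\<^sub>R (s (r k) x - f x)) \<partial>M)"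
          unfolding set_lebesgue_integral_def by (rule integral_norm_bound)
        also have "\<dots> \<le> (\<integral>x. norm (s (r k) x - f x) \<partial>M)"
          using lim.hyps by (intro integral_mono integrable_norm integrable_mult_indicator) (auto simp: indicator_def)
        finally show ?thesis using r[of k] by simp
      qed
      have "(\<lambda>k. (1/2::real) ^ k) \<longlonglongrightarrow> 0" by (intro LIMSEQ_power_zero) simp
      then have "(\<lambda>k. (\<integral>x\<in>A. E k x \<partial>M) - (\<integral>x\<in>A. f x \<partial>M)) \<longlonglongrightarrow> 0"
        by (rule Lim_null_comparison[rotated]) (use le in auto)
      then show "(\<lambda>k. \<integral>x\<in>A. E k x \<partial>M) \<longlonglongrightarrow> (\<integral>x\<in>A. f x \<partial>M)"
        by (simp add: LIM_zero_iff)
    qed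
    then have "is_cond_exp M F f L"
      using lim.hyps L_int L_meas by (auto simp: is_cond_exp_def)
    then show ?case by blast
  qed
qed

text \<open>Tested on the set where \<open>g\<close> exceeds \<open>s\<close>, the hypothesis makes
  a nonnegative function have nonpositive integral. Conditional bounds are carried as set-integral
  bounds throughout, and this is the way back to almost sure ones.\<close>

lemma AE_le_of_set_integral_le:
  fixes g :: "'a \<Rightarrow> real"
  assumes fin: "finite_measure M" and sub: "subalgebra M F"
    and g: "g \<in> borel_measurable F" "integrable M g"
    and le: "\<And>A. A \<in> sets F \<Longrightarrow> (\<integral>x\<in>A. g x \<partial>M) \<le> s * measure M A"
  shows "AE x in M. g x \<le> s"
proof -
  interpret finite_measure M by fact
  define A where "A = {x \<in> space F. s < g x}"
  have A: "A \<in> sets F" unfolding A_def using g(1) by measurable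
  then have AM: "A \<in> sets M" using sub by (auto simp: subalgebra_def)
  have int: "integrable M (\<lambda>x. indicator A x * g x)" "integrable M (\<lambda>x. indicator A x * s)"
    using integrable_mult_indicator[OF AM g(2)] integrable_mult_indicator[OF AM integrable_const[of s]] by auto
  have "(\<integral>x. indicator A x * g x - indicator A x * s \<partial>M) = (\<integral>x\<in>A. g x \<partial>M) - s * measure M A"
    using int AM by (simp add: set_lebesgue_integral_def)
  also have "\<dots> \<le> 0" using le[OF A] by simp
  finally have "(\<integral>x. indicator A x * g x - indicator A x * s \<partial>M) \<le> 0" .
  moreover have nonneg: "0 \<le> indicator A x * g x - indicator A x * s" for x
    by (auto simp: A_def indicator_def)
  ultimately have "(\<integral>x. indicator A x * g x - indicator A x * s \<partial>M) = 0"
    by (simp add: Bochner_Integration.integral_nonneg order_antisym)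
  then have "AE x in M. indicator A x * g x - indicator A x * s = 0"
    using int nonneg by (subst (asm) integral_nonneg_eq_0_iff_AE) auto
  then show ?thesis using AE_space
    by eventually_elim (use sub in \<open>auto simp: A_def subalgebra_def indicator_def split: if_splits\<close>)
qed

text \<open>Passes from indicators to nonnegative \<open>F\<close>-measurable weights through the
  almost sure bound on the conditional expectation. It serves for second moments weighted by
  \<open>cosh (norm (S x))\<close>.\<close>

lemma integral_mult_le_of_set_integral_le:
  fixes f W :: "'a \<Rightarrow> real"
  assumes fin: "finite_measure M" and sfs: "sigma_finite_subalgebra M F"
    and f: "integrable M f"
    and le: "\<And>A. A \<in> sets F \<Longrightarrow> (\<integral>x\<in>A. f x \<partial>M) \<le> s * measure M A"
    and W: "W \<in> borel_measurable F" "\<And>x. x \<in> space M \<Longrightarrow> 0 \<le> W x" "\<And>x. x \<in> space M \<Longrightarrow> W x \<le> K"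
  shows "(\<integral>x. W x * f x \<partial>M) \<le> s * (\<integral>x. W x \<partial>M)"
proof -
  interpret finite_measure M by fact
  interpret sigma_finite_subalgebra M F by fact
  have [measurable]: "f \<in> borel_measurable M" using f by auto
  have WM[measurable]: "W \<in> borel_measurable M" by (rule measurable_from_subalg[OF subalg W(1)])
  have W_int: "integrable M W" using W by (intro integrable_const_bound[of _ K]) auto
  have Wf: "integrable M (\<lambda>x. W x * f x)"
  proof (rule Bochner_Integration.integrable_bound[of M "\<lambda>x. K * f x"])
    show "AE x in M. norm (W x * f x) \<le> norm (K * f x)"
      using W by (intro AE_I2) (force simp: abs_mult intro!: mult_right_mono)
  qed (use f in auto)
  have "AE x in M. real_cond_exp M F f x \<le> s"
    by (rule AE_le_of_set_integral_le[OF fin subalg]) (use real_cond_exp_int[OF f] le real_cond_exp_intA[OF f] in auto)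
  then have AE: "AE x in M. W x * real_cond_exp M F f x \<le> W x * s"
    using AE_space by eventually_elim (use W in \<open>auto intro: mult_left_mono\<close>)
  have "(\<integral>x. W x * f x \<partial>M) = (\<integral>x. W x * real_cond_exp M F f x \<partial>M)"
    using real_cond_exp_intg(2)[OF Wf W(1)] by simp
  also have "\<dots> \<le> (\<integral>x. W x * s \<partial>M)"
    by (rule integral_mono_AE[OF real_cond_exp_intg(1)[OF Wf W(1)] _ AE]) (use W_int in auto)
  finally show ?thesis by (simp add: mult.commute)
qed

lemma
  shows borel_measurable_cosh_real[measurable]: "cosh \<in> borel_measurable (borel :: real measure)"
    and borel_measurable_sinh_real[measurable]: "sinh \<in> borel_measurable (borel :: real measure)"
  by (auto intro!: borel_measurable_continuous_onI continuous_intros)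

subsection \<open>Exponential supermartingale\<close>

text \<open>In the expansion of \<open>cosh_norm_add_le\<close> the linear term is a pairing with an
  \<open>F\<close>-measurable functional and averages to 0. The remainder is at most a constant
  times \<open>cosh (norm (S x)) * (norm (\<xi> x))\<^sup>2\<close>, whose conditional size is
  governed by \<open>s\<close>.\<close>

lemma cosh_norm_step:
  fixes S \<xi> :: "'a \<Rightarrow> 'b::{banach, second_countable_topology}"
  assumes smooth: "beta_smooth \<beta> TYPE('b)" and fin: "finite_measure M"
    and sfs: "sigma_finite_subalgebra M F"
    and S: "S \<in> borel_measurable F" "\<And>x. x \<in> space M \<Longrightarrow> norm (S x) \<le> K"
    and \<xi>: "\<xi> \<in> borel_measurable M" "\<And>x. x \<in> space M \<Longrightarrow> norm (\<xi> x) \<le> b" and b: "0 < b"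
    and zero: "\<And>A. A \<in> sets F \<Longrightarrow> (\<integral>x\<in>A. \<xi> x \<partial>M) = 0"
    and sq: "\<And>A. A \<in> sets F \<Longrightarrow> (\<integral>x\<in>A. (norm (\<xi> x))\<^sup>2 \<partial>M) \<le> s * measure M A"
    and A: "A \<in> sets F"
  shows "(\<integral>x\<in>A. cosh (norm (S x + \<xi> x)) \<partial>M)
    \<le> (1 + \<beta>\<^sup>2 * ((exp b - b - 1) / b\<^sup>2) * s) * (\<integral>x\<in>A. cosh (norm (S x)) \<partial>M)"
proof -
  interpret finite_measure M by fact
  interpret sigma_finite_subalgebra M F by fact
  define c where "c = (exp b - b - 1) / b\<^sup>2"
  have AM[measurable]: "A \<in> sets M" using A subalg by (auto simp: subalgebra_def)
  have SM[measurable]: "S \<in> borel_measurable M" by (rule measurable_from_subalg[OF subalg S(1)])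
  note [measurable] = \<xi>(1)
  have \<xi>_int: "integrable M \<xi>" using \<xi> by (intro integrable_const_bound[of _ b]) auto
  \<comment> \<open>\<open>sinh\<close> is 0 at 0, so this weight vanishes together with
    \<open>S\<close>, as the pairing lemmas demand.\<close>
  define w where "w = (\<lambda>x. indicator A x * sinh (norm (S x)))"
  define W where "W = (\<lambda>x. indicator A x * cosh (norm (S x)))"
  have wF: "w \<in> borel_measurable F" "W \<in> borel_measurable F"
    unfolding w_def W_def using S(1) A by measurable
  have WM[measurable]: "W \<in> borel_measurable M" by (rule measurable_from_subalg[OF subalg wF(2)])
  have w_bd: "\<bar>w x\<bar> \<le> sinh K" if "x \<in> space M" for x
    using S(2)[OF that] by (auto simp: w_def indicator_def order_trans[OF norm_ge_zero])
  have w0: "w x = 0" if "S x = 0" for x using that by (simp add: w_def)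
  have W0: "0 \<le> W x" for x by (auto simp: W_def indicator_def)
  have W_bd: "W x \<le> cosh K" if "x \<in> space M" for x
    using S(2)[OF that] by (auto simp: W_def indicator_def cosh_real_nonneg_le_iff order_trans[OF norm_ge_zero])
  have W_int: "integrable M W" using W0 W_bd by (intro integrable_const_bound[of _ "cosh K"]) auto
  have sq_int: "integrable M (\<lambda>x. (norm (\<xi> x))\<^sup>2)"
    using \<xi>(2) by (intro integrable_const_bound[of _ "b\<^sup>2"]) (auto intro!: power_mono)
  have Wsq_int: "integrable M (\<lambda>x. W x * (norm (\<xi> x))\<^sup>2)"
  proof (rule integrable_const_bound[of _ "cosh K * b\<^sup>2"])
    show "AE x in M. norm (W x * (norm (\<xi> x))\<^sup>2) \<le> cosh K * b\<^sup>2"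
      using W0 W_bd \<xi>(2) by (intro AE_I2) (auto simp: abs_mult intro!: mult_mono power_mono)
  qed auto
  have nd: "integrable M (\<lambda>x. w x * norm_deriv (S x) (\<xi> x))"
    "(\<integral>x. w x * norm_deriv (S x) (\<xi> x) \<partial>M) = 0"
    by (rule integrable_norm_deriv[OF smooth subalg \<xi>_int S(1) wF(1) w_bd w0]
             integral_norm_deriv_eq_0[OF smooth subalg \<xi>_int S(1) wF(1) w_bd w0 zero]; assumption)+
  have "(\<integral>x\<in>A. cosh (norm (S x + \<xi> x)) \<partial>M)
      \<le> (\<integral>x. (W x + w x * norm_deriv (S x) (\<xi> x)) + \<beta>\<^sup>2 * c * (W x * (norm (\<xi> x))\<^sup>2) \<partial>M)"
    unfolding set_lebesgue_integral_def
  proof (rule integral_mono)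
    show "integrable M (\<lambda>x. indicat_real A x *\<^sub>R cosh (norm (S x + \<xi> x)))"
    proof (rule integrable_const_bound[of _ "cosh (K + b)"])
      show "AE x in M. norm (indicat_real A x *\<^sub>R cosh (norm (S x + \<xi> x))) \<le> cosh (K + b)"
      proof (rule AE_I2)
        fix x assume x: "x \<in> space M"
        have "norm (S x + \<xi> x) \<le> K + b" using S(2)[OF x] \<xi>(2)[OF x] by (intro norm_triangle_le) simp
        then have "cosh (norm (S x + \<xi> x)) \<le> cosh (K + b)"
          by (subst cosh_real_nonneg_le_iff) (auto intro: order_trans[OF norm_ge_zero])
        then show "norm (indicat_real A x *\<^sub>R cosh (norm (S x + \<xi> x))) \<le> cosh (K + b)"
          by (auto simp: indicator_def)
      qed
    qed measurable
    show "integrable M (\<lambda>x. W x + w x * norm_deriv (S x) (\<xi> x) + \<beta>\<^sup>2 * c * (W x * (norm (\<xi> x))\<^sup>2))"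
      by (intro Bochner_Integration.integrable_add integrable_mult_right W_int nd Wsq_int)
    fix x assume x: "x \<in> space M"
    have "exp (norm (\<xi> x)) - 1 - norm (\<xi> x) \<le> (norm (\<xi> x))\<^sup>2 * c"
      unfolding c_def using \<xi>(2)[OF x] b by (intro exp_minus_linear_le) auto
    then have "\<beta>\<^sup>2 * cosh (norm (S x)) * (exp (norm (\<xi> x)) - 1 - norm (\<xi> x))
        \<le> \<beta>\<^sup>2 * cosh (norm (S x)) * ((norm (\<xi> x))\<^sup>2 * c)"
      by (intro mult_left_mono) auto
    then show "indicat_real A x *\<^sub>R cosh (norm (S x + \<xi> x))
        \<le> W x + w x * norm_deriv (S x) (\<xi> x) + \<beta>\<^sup>2 * c * (W x * (norm (\<xi> x))\<^sup>2)"
      using cosh_norm_add_le[OF smooth, of "S x" "\<xi> x"]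
      by (auto simp: W_def w_def indicator_def algebra_simps)
  qed
  also have "\<dots> = (\<integral>x. W x \<partial>M) + \<beta>\<^sup>2 * c * (\<integral>x. W x * (norm (\<xi> x))\<^sup>2 \<partial>M)"
    using W_int nd Wsq_int by simp
  also have "\<dots> \<le> (\<integral>x. W x \<partial>M) + \<beta>\<^sup>2 * c * (s * (\<integral>x. W x \<partial>M))"
  proof -
    have "exp b - b - 1 \<ge> 0" using exp_ge_add_one_self[of b] by linarith
    then have "c \<ge> 0" by (simp add: c_def)
    moreover have "(\<integral>x. W x * (norm (\<xi> x))\<^sup>2 \<partial>M) \<le> s * (\<integral>x. W x \<partial>M)"
      by (rule integral_mult_le_of_set_integral_le[OF fin sfs sq_int sq wF(2) W0 W_bd])
    ultimately show ?thesis by (intro add_left_mono mult_left_mono) auto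
  qed
  also have "\<dots> = (1 + \<beta>\<^sup>2 * c * s) * (\<integral>x\<in>A. cosh (norm (S x)) \<partial>M)"
    by (simp add: set_lebesgue_integral_def W_def algebra_simps)
  finally show ?thesis unfolding c_def .
qed

text \<open>First-passage argument: with \<open>B n\<close> the event of a crossing up to time
  \<open>n\<close>, the sum of \<open>a * measure M (B n)\<close> and the integral of
  \<open>W n\<close> off \<open>B n\<close> stays below the initial mean. A step moves the newly
  crossed part, where \<open>W (Suc n)\<close> is at least \<open>a\<close>, from the second summand
  to the first.\<close>

lemma supermartingale_maximal:
  fixes W :: "nat \<Rightarrow> 'a \<Rightarrow> real"
  assumes fin: "finite_measure M" and sub: "\<And>i. subalgebra M (G i)"
    and mono: "\<And>i j. i \<le> j \<Longrightarrow> sets (G i) \<subseteq> sets (G j)"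
    and W: "\<And>i. W i \<in> borel_measurable (G i)" "\<And>i. integrable M (W i)" "\<And>i x. 0 \<le> W i x"
    and step: "\<And>i A. A \<in> sets (G i) \<Longrightarrow> (\<integral>x\<in>A. W (Suc i) x \<partial>M) \<le> (\<integral>x\<in>A. W i x \<partial>M)"
  shows "a * measure M {x \<in> space M. \<exists>i\<le>n. a \<le> W i x} \<le> (\<integral>x. W 0 x \<partial>M)"
proof -
  interpret finite_measure M by fact
  have sp: "space (G i) = space M" for i using sub by (auto simp: subalgebra_def)
  define B where "B = (\<lambda>n. {x \<in> space M. \<exists>i\<le>n. a \<le> W i x})"
  have Bi: "{x \<in> space M. a \<le> W i x} \<in> sets (G i)" for i
    using W(1)[of i] unfolding sp[of i, symmetric] by measurable
  have BG: "B n \<in> sets (G n)" for n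
  proof -
    have "B n = (\<Union>i\<le>n. {x \<in> space M. a \<le> W i x})" by (auto simp: B_def)
    also have "\<dots> \<in> sets (G n)" using Bi mono by (intro sets.finite_UN) auto
    finally show ?thesis .
  qed
  have CG: "space M - B n \<in> sets (G n)" for n using BG[of n] sp[of n] by (metis sets.compl_sets)
  have M_sets: "A \<in> sets M" if "A \<in> sets (G n)" for A n using that sub by (auto simp: subalgebra_def)
  have ind: "integrable M (\<lambda>x. indicator A x * W i x)" if "A \<in> sets M" for A i
    using integrable_mult_indicator[OF that W(2)[of i]] by simp
  have a_ind: "integrable M (\<lambda>x. indicator A x * a)" if "A \<in> sets M" for A
    using integrable_mult_indicator[OF that integrable_const[of a]] by simp
  have "a * measure M (B n) + (\<integral>x\<in>space M - B n. W n x \<partial>M) \<le> (\<integral>x. W 0 x \<partial>M)"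
  proof (induction n)
    case 0
    note m = M_sets[OF BG] M_sets[OF CG]
    have "a * measure M (B 0) + (\<integral>x\<in>space M - B 0. W 0 x \<partial>M)
        = (\<integral>x. indicator (B 0) x * a + indicator (space M - B 0) x * W 0 x \<partial>M)"
      using a_ind[OF m(1)] ind[OF m(2)] m(1) by (simp add: set_lebesgue_integral_def)
    also have "\<dots> \<le> (\<integral>x. W 0 x \<partial>M)"
    proof (rule integral_mono)
      show "indicator (B 0) x * a + indicator (space M - B 0) x * W 0 x \<le> W 0 x" for x
        using W(3)[of 0 x] by (auto simp: B_def indicator_def)
    qed (use a_ind[OF m(1)] ind[OF m(2)] W in auto)
    finally show ?case .
  next
    case (Suc n)
    note m = M_sets[OF BG] M_sets[OF CG]
    let ?D = "B (Suc n) - B n"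
    have D: "?D \<in> sets M" using m by auto
    have "B n \<subseteq> B (Suc n)" by (auto simp: B_def intro: le_SucI)
    then have "measure M (B (Suc n)) = measure M (B n) + measure M ?D"
      using m(1) by (simp add: finite_measure_Diff)
    then have "a * measure M (B (Suc n)) + (\<integral>x\<in>space M - B (Suc n). W (Suc n) x \<partial>M)
        = a * measure M (B n) + (\<integral>x. indicator ?D x * a + indicator (space M - B (Suc n)) x * W (Suc n) x \<partial>M)"
      using a_ind[OF D] ind[OF m(2)] D by (simp add: set_lebesgue_integral_def algebra_simps)
    also have "(\<integral>x. indicator ?D x * a + indicator (space M - B (Suc n)) x * W (Suc n) x \<partial>M)
        \<le> (\<integral>x. indicator (space M - B n) x * W (Suc n) x \<partial>M)"
    proof (rule integral_mono)
      fix x assume "x \<in> space M"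
      then show "indicator ?D x * a + indicator (space M - B (Suc n)) x * W (Suc n) x
          \<le> indicator (space M - B n) x * W (Suc n) x"
        using W(3)[of "Suc n" x] by (auto simp: B_def indicator_def le_Suc_eq)
    qed (use a_ind[OF D] ind[OF m(2)] in auto)
    also have "\<dots> \<le> (\<integral>x\<in>space M - B n. W n x \<partial>M)"
      using step[OF CG] by (simp add: set_lebesgue_integral_def)
    finally show ?case using Suc by simp
  qed
  moreover have "0 \<le> (\<integral>x\<in>space M - B n. W n x \<partial>M)"
    unfolding set_lebesgue_integral_def using W(3) by (intro Bochner_Integration.integral_nonneg) simp
  ultimately show ?thesis by (simp add: B_def)
qed

text \<open>In a Hilbert space the cross term with \<open>D\<close> averages out and centring does
  not increase the second moment. In general \<open>norm (f x - D x)\<close> is bounded by a sum of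
  two norms, whose square costs 2 for each, and the second moment of \<open>D\<close> is at most
  that of \<open>f\<close>: together 4.\<close>

lemma is_cond_exp_sq_le:
  fixes f D :: "'a \<Rightarrow> 'b::{banach, second_countable_topology}"
  assumes smooth: "beta_smooth \<beta> TYPE('b)" and fin: "finite_measure M"
    and sub: "subalgebra M F"
    and ce: "is_cond_exp M F f D"
    and f: "\<And>x. x \<in> space M \<Longrightarrow> norm (f x) \<le> K" and D: "\<And>x. x \<in> space M \<Longrightarrow> norm (D x) \<le> K"
    and A: "A \<in> sets F"
  shows "(\<integral>x\<in>A. (norm (f x - D x))\<^sup>2 \<partial>M)
    \<le> (if is_hilbert TYPE('b) then 1 else 4) * (\<integral>x\<in>A. (norm (f x))\<^sup>2 \<partial>M)"
proof -
  interpret finite_measure M by fact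
  have fi: "integrable M f" and Di: "integrable M D" and DF[measurable]: "D \<in> borel_measurable F"
    using ce by (auto simp: is_cond_exp_def)
  have AM[measurable]: "A \<in> sets M" using A sub by (auto simp: subalgebra_def)
  note [measurable] = borel_measurable_integrable[OF fi] borel_measurable_integrable[OF Di]
  \<comment> \<open>With this weight the pairing is, on \<open>A\<close>, the derivative of half the
    squared norm at \<open>D x\<close>; in a Hilbert space it is the inner product with
    \<open>D x\<close>.\<close>
  define w where "w = (\<lambda>x. indicator A x * norm (D x))"
  have w: "w \<in> borel_measurable F" unfolding w_def using A by measurable
  have w_bd: "\<bar>w x\<bar> \<le> K" if "x \<in> space M" for x
    using D[OF that] by (auto simp: w_def indicator_def order_trans[OF norm_ge_zero])
  have w0: "w x = 0" if "D x = 0" for x using that by (simp add: w_def)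
  have sqi: "integrable M (\<lambda>x. indicator A x * (norm (h x))\<^sup>2)"
    if [measurable]: "h \<in> borel_measurable M" and "\<And>x. x \<in> space M \<Longrightarrow> norm (h x) \<le> L" for h :: "'a \<Rightarrow> 'b" and L
    by (rule integrable_const_bound[of _ "L\<^sup>2"])
       (use that in \<open>auto simp: indicator_def intro!: power_mono AE_I2\<close>)
  note fs = sqi[of f K] and Ds = sqi[of D K]
  have "norm (f x - D x) \<le> K + K" if "x \<in> space M" for x
    using norm_triangle_ineq4[of "f x" "D x"] f[OF that] D[OF that] by linarith
  then have ds: "integrable M (\<lambda>x. indicator A x * (norm (f x - D x))\<^sup>2)"
    by (intro sqi[of _ "K + K"]) auto
  have ndf: "integrable M (\<lambda>x. w x * norm_deriv (D x) (f x))"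
    by (rule integrable_norm_deriv[OF smooth sub fi DF w w_bd w0])
  have ndd: "integrable M (\<lambda>x. w x * norm_deriv (D x) (D x))"
    by (rule integrable_norm_deriv[OF smooth sub Di DF w w_bd w0])
  have nd_eq: "(\<integral>x. w x * norm_deriv (D x) (f x) \<partial>M) = (\<integral>x. w x * norm_deriv (D x) (D x) \<partial>M)"
    by (rule is_cond_exp_integral_norm_deriv[OF smooth sub ce DF w w_bd w0])
  show ?thesis
  proof (cases "is_hilbert TYPE('b)")
    case True
    then obtain ip :: "'b \<Rightarrow> 'b \<Rightarrow> real" where ip:
        "\<And>x y z. ip (x + y) z = ip x z + ip y z" "\<And>c x y. ip (c *\<^sub>R x) y = c * ip x y"
        "\<And>x y. ip x y = ip y x" "\<And>x. norm x = sqrt (ip x x)"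
      unfolding is_hilbert_def by blast
    have "(\<integral>x\<in>A. (norm (f x - D x))\<^sup>2 \<partial>M)
        \<le> (\<integral>x. indicator A x * (norm (f x))\<^sup>2 - 2 * (w x * norm_deriv (D x) (f x) - w x * norm_deriv (D x) (D x)) \<partial>M)"
      unfolding set_lebesgue_integral_def
    proof (rule integral_mono)
      fix x
      have "norm_deriv (D x) (f x - D x) = norm_deriv (D x) (f x) - norm_deriv (D x) (D x)"
        by (simp add: linear_simps[OF bounded_linear_norm_deriv[OF smooth]])
      then have "(norm (f x))\<^sup>2 = (norm (D x))\<^sup>2
          + 2 * norm (D x) * (norm_deriv (D x) (f x) - norm_deriv (D x) (D x)) + (norm (f x - D x))\<^sup>2"
        using norm_deriv_inner[OF ip, of "D x" "f x - D x"] by simp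
      then have "(norm (f x - D x))\<^sup>2 \<le> (norm (f x))\<^sup>2
          - 2 * (norm (D x) * norm_deriv (D x) (f x) - norm (D x) * norm_deriv (D x) (D x))"
        by (simp add: algebra_simps)
      then show "indicat_real A x *\<^sub>R (norm (f x - D x))\<^sup>2 \<le> indicator A x * (norm (f x))\<^sup>2
          - 2 * (w x * norm_deriv (D x) (f x) - w x * norm_deriv (D x) (D x))"
        by (auto simp: w_def indicator_def)
    qed (use ds fs f ndf ndd in auto)
    also have "\<dots> = (\<integral>x\<in>A. (norm (f x))\<^sup>2 \<partial>M)"
      using fs f ndf ndd nd_eq by (simp add: set_lebesgue_integral_def)
    finally show ?thesis using True by simp
  next
    case False
    \<comment> \<open>The squared norm of \<open>D\<close> integrates to the pairing with
      \<open>f\<close>, which is at most the mean of the two squares; half of the left side is then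
      absorbed.\<close>
    have "(\<integral>x\<in>A. (norm (D x))\<^sup>2 \<partial>M) = (\<integral>x. w x * norm_deriv (D x) (f x) \<partial>M)"
      unfolding nd_eq by (simp add: w_def norm_deriv_self set_lebesgue_integral_def power2_eq_square mult.assoc)
    also have "\<dots> \<le> (\<integral>x. (indicator A x * (norm (D x))\<^sup>2 + indicator A x * (norm (f x))\<^sup>2) / 2 \<partial>M)"
    proof (rule integral_mono)
      fix x
      have "norm (D x) * norm_deriv (D x) (f x) \<le> norm (D x) * norm (f x)"
        using norm_deriv_abs_le[of "D x" "f x"] by (intro mult_left_mono) auto
      also have "\<dots> \<le> ((norm (D x))\<^sup>2 + (norm (f x))\<^sup>2) / 2"
        using sum_squares_bound[of "norm (D x)" "norm (f x)"] by simp
      finally show "w x * norm_deriv (D x) (f x)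
          \<le> (indicator A x * (norm (D x))\<^sup>2 + indicator A x * (norm (f x))\<^sup>2) / 2"
        by (auto simp: w_def indicator_def)
    qed (use fs Ds f D ndf in auto)
    also have "\<dots> = ((\<integral>x\<in>A. (norm (D x))\<^sup>2 \<partial>M) + (\<integral>x\<in>A. (norm (f x))\<^sup>2 \<partial>M)) / 2"
      using fs Ds f D by (simp add: set_lebesgue_integral_def)
    finally have D_le: "(\<integral>x\<in>A. (norm (D x))\<^sup>2 \<partial>M) \<le> (\<integral>x\<in>A. (norm (f x))\<^sup>2 \<partial>M)" by simp
    have "(\<integral>x\<in>A. (norm (f x - D x))\<^sup>2 \<partial>M)
        \<le> (\<integral>x. 2 * (indicator A x * (norm (f x))\<^sup>2) + 2 * (indicator A x * (norm (D x))\<^sup>2) \<partial>M)"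
      unfolding set_lebesgue_integral_def
    proof (rule integral_mono)
      fix x
      have "(norm (f x - D x))\<^sup>2 \<le> (norm (f x) + norm (D x))\<^sup>2"
        by (intro power_mono norm_triangle_ineq4) auto
      also have "\<dots> \<le> 2 * (norm (f x))\<^sup>2 + 2 * (norm (D x))\<^sup>2"
        using sum_squares_bound[of "norm (f x)" "norm (D x)"] by (simp add: power2_sum)
      finally show "indicat_real A x *\<^sub>R (norm (f x - D x))\<^sup>2
          \<le> 2 * (indicator A x * (norm (f x))\<^sup>2) + 2 * (indicator A x * (norm (D x))\<^sup>2)"
        by (auto simp: indicator_def)
    qed (use ds fs Ds f D in auto)
    also have "\<dots> = 2 * (\<integral>x\<in>A. (norm (f x))\<^sup>2 \<partial>M) + 2 * (\<integral>x\<in>A. (norm (D x))\<^sup>2 \<partial>M)"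
      using fs Ds f D by (simp add: set_lebesgue_integral_def)
    finally show ?thesis using D_le False by simp
  qed
qed

text \<open>Since \<open>V\<close> is deterministic,
  \<open>exp (- (\<kappa> * real n)) * cosh (norm (U n x))\<close>, with \<open>U\<close> the
  martingale divided by \<beta>, is a nonnegative supermartingale started at 1. The maximal
  inequality then controls all \<open>n \<le> N\<close> at the cost of one event, as is required for
  all sample sizes of a block together.\<close>

lemma martingale_tail:
  fixes T D :: "nat \<Rightarrow> 'a \<Rightarrow> 'b::{banach, second_countable_topology}"
  assumes smooth: "beta_smooth \<beta> TYPE('b)" and beta: "\<beta> > 0" and prob: "prob_space M"
    and sfs: "\<And>i. sigma_finite_subalgebra M (G i)"
    and mono: "\<And>i j. i \<le> j \<Longrightarrow> sets (G i) \<subseteq> sets (G j)"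
    and T: "\<And>i. T i \<in> borel_measurable (G (Suc i))" "\<And>i x. x \<in> space M \<Longrightarrow> norm (T i x) \<le> 1"
    and D: "\<And>i. is_cond_exp M (G i) (T i) (D i)" "\<And>i x. x \<in> space M \<Longrightarrow> norm (D i x) \<le> 1"
    and V: "V \<ge> 0" "\<And>i A. A \<in> sets (G i) \<Longrightarrow> (\<integral>x\<in>A. (norm (T i x))\<^sup>2 \<partial>M) \<le> V * measure M A"
    and \<alpha>: "0 < \<alpha>"
    and \<kappa>: "\<kappa> = (if is_hilbert TYPE('b) then 1 else 4) * V * ((exp (2 / \<beta>) - 2 / \<beta> - 1) / (2 / \<beta>)\<^sup>2)"
  shows "{x \<in> space M. \<exists>n\<le>N. \<beta> * ln (2 / \<alpha>) + \<beta> * \<kappa> * real n \<le> norm (\<Sum>i<n. T i x - D i x)} \<in> sets M"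
    and "measure M {x \<in> space M. \<exists>n\<le>N. \<beta> * ln (2 / \<alpha>) + \<beta> * \<kappa> * real n \<le> norm (\<Sum>i<n. T i x - D i x)} \<le> \<alpha>"
proof -
  interpret prob_space M by fact
  have fin: "finite_measure M" by unfold_locales
  have sub: "subalgebra M (G i)" for i using sfs by (simp add: sigma_finite_subalgebra_def)
  have sub': "subalgebra (G j) (G i)" if "i \<le> j" for i j
    using sub mono[OF that] by (auto simp: subalgebra_def)
  define S where "S = (\<lambda>n x. \<Sum>i<n. T i x - D i x)"
  \<comment> \<open>Division by \<beta> cancels the factor \<open>\<beta>\<^sup>2\<close> of the
    one-step bound and turns the bound 2 on the centred increments into
    \<open>2 / \<beta>\<close>.\<close>
  define U where "U = (\<lambda>n x. (1 / \<beta>) *\<^sub>R S n x)"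
  define \<xi> where "\<xi> = (\<lambda>i x. (1 / \<beta>) *\<^sub>R (T i x - D i x))"
  define W where "W = (\<lambda>n x. exp (- (\<kappa> * real n)) * cosh (norm (U n x)))"
  define q :: real where "q = (if is_hilbert TYPE('b) then 1 else 4)"
  have D_meas: "D i \<in> borel_measurable (G i)" for i using D(1) by (simp add: is_cond_exp_def)
  have S_meas: "S n \<in> borel_measurable (G n)" for n
    unfolding S_def
    by (intro borel_measurable_sum borel_measurable_diff measurable_from_subalg[OF sub' T(1)]
          measurable_from_subalg[OF sub' D_meas]) auto
  have U_meas: "U n \<in> borel_measurable (G n)" for n unfolding U_def using S_meas by measurable
  have SM[measurable]: "S n \<in> borel_measurable M" for n by (rule measurable_from_subalg[OF sub S_meas])
  have TD: "norm (T i x - D i x) \<le> 2" if "x \<in> space M" for i x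
    using norm_triangle_ineq4[of "T i x" "D i x"] T(2)[OF that, of i] D(2)[OF that, of i] by linarith
  have U_bd: "norm (U n x) \<le> 2 * real n / \<beta>" if "x \<in> space M" for n x
  proof -
    have "norm (S n x) \<le> (\<Sum>i<n. 2)" unfolding S_def by (rule sum_norm_le) (rule TD[OF that])
    then show ?thesis using beta by (simp add: U_def divide_right_mono)
  qed
  have [measurable]: "T i \<in> borel_measurable M" "D i \<in> borel_measurable M" for i
    using measurable_from_subalg[OF sub T(1)] measurable_from_subalg[OF sub D_meas] by auto
  have \<xi>_meas: "\<xi> i \<in> borel_measurable M" for i unfolding \<xi>_def by measurable
  have \<xi>_bd: "norm (\<xi> i x) \<le> 2 / \<beta>" if "x \<in> space M" for i x
    using TD[OF that, of i] beta by (simp add: \<xi>_def divide_right_mono)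
  have si: "set_integrable M A (T i)" "set_integrable M A (D i)" if "A \<in> sets (G i)" for A i
    using that sub[of i] D(1)[of i]
    by (auto simp: set_integrable_def subalgebra_def is_cond_exp_def intro: integrable_mult_indicator)
  have \<xi>_zero: "(\<integral>x\<in>A. \<xi> i x \<partial>M) = 0" if A: "A \<in> sets (G i)" for A i
  proof -
    have "(\<integral>x\<in>A. T i x - D i x \<partial>M) = 0"
      using D(1)[of i] A si[OF A] by (simp add: set_integral_diff is_cond_exp_def)
    then show ?thesis unfolding \<xi>_def by (simp add: set_lebesgue_integral_def scaleR_left_commute[of _ "1 / \<beta>"])
  qed
  have \<xi>_sq: "(\<integral>x\<in>A. (norm (\<xi> i x))\<^sup>2 \<partial>M) \<le> q * V / \<beta>\<^sup>2 * measure M A" if A: "A \<in> sets (G i)" for A i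
  proof -
    have "(\<integral>x\<in>A. (norm (\<xi> i x))\<^sup>2 \<partial>M) = (\<integral>x\<in>A. (1 / \<beta>\<^sup>2) * (norm (T i x - D i x))\<^sup>2 \<partial>M)"
      by (simp add: \<xi>_def power_divide)
    also have "\<dots> = (1 / \<beta>\<^sup>2) * (\<integral>x\<in>A. (norm (T i x - D i x))\<^sup>2 \<partial>M)"
      by (rule set_integral_mult_right)
    also have "\<dots> \<le> (1 / \<beta>\<^sup>2) * (q * (V * measure M A))"
    proof (intro mult_left_mono)
      have "(\<integral>x\<in>A. (norm (T i x - D i x))\<^sup>2 \<partial>M) \<le> q * (\<integral>x\<in>A. (norm (T i x))\<^sup>2 \<partial>M)"
        unfolding q_def by (rule is_cond_exp_sq_le[OF smooth fin sub D(1) T(2) D(2) A])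
      also have "\<dots> \<le> q * (V * measure M A)"
        by (intro mult_left_mono V A) (simp add: q_def)
      finally show "(\<integral>x\<in>A. (norm (T i x - D i x))\<^sup>2 \<partial>M) \<le> q * (V * measure M A)" .
    qed simp
    finally show ?thesis by simp
  qed
  have W_meas: "W n \<in> borel_measurable (G n)" for n
    unfolding W_def using U_meas by measurable
  have W_int: "integrable M (W n)" for n
  proof (rule integrable_const_bound[of _ "exp (- (\<kappa> * real n)) * cosh (2 * real n / \<beta>)"])
    show "AE x in M. norm (W n x) \<le> exp (- (\<kappa> * real n)) * cosh (2 * real n / \<beta>)"
      using U_bd beta by (intro AE_I2) (auto simp: W_def abs_mult cosh_real_nonneg_le_iff)
  qed (rule measurable_from_subalg[OF sub W_meas])
  have W_nonneg: "0 \<le> W n x" for n x by (simp add: W_def)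
  have step: "(\<integral>x\<in>A. W (Suc i) x \<partial>M) \<le> (\<integral>x\<in>A. W i x \<partial>M)" if A: "A \<in> sets (G i)" for A i
  proof -
    have U_Suc: "U (Suc i) x = U i x + \<xi> i x" for x
      by (simp add: U_def S_def \<xi>_def algebra_simps)
    have int_nonneg: "0 \<le> (\<integral>x\<in>A. cosh (norm (U i x)) \<partial>M)"
      unfolding set_lebesgue_integral_def by (intro Bochner_Integration.integral_nonneg) simp
    have "(\<integral>x\<in>A. cosh (norm (U (Suc i) x)) \<partial>M)
        \<le> (1 + \<beta>\<^sup>2 * ((exp (2 / \<beta>) - 2 / \<beta> - 1) / (2 / \<beta>)\<^sup>2) * (q * V / \<beta>\<^sup>2)) * (\<integral>x\<in>A. cosh (norm (U i x)) \<partial>M)"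
      unfolding U_Suc
      by (rule cosh_norm_step[OF smooth fin sfs U_meas U_bd \<xi>_meas \<xi>_bd _ \<xi>_zero \<xi>_sq A]) (use beta in auto)
    also have "\<beta>\<^sup>2 * ((exp (2 / \<beta>) - 2 / \<beta> - 1) / (2 / \<beta>)\<^sup>2) * (q * V / \<beta>\<^sup>2) = \<kappa>"
      using beta unfolding \<kappa> q_def by simp
    also have "(1 + \<kappa>) * (\<integral>x\<in>A. cosh (norm (U i x)) \<partial>M) \<le> exp \<kappa> * (\<integral>x\<in>A. cosh (norm (U i x)) \<partial>M)"
      using int_nonneg exp_ge_add_one_self by (rule mult_right_mono[rotated])
    finally have le: "(\<integral>x\<in>A. cosh (norm (U (Suc i) x)) \<partial>M) \<le> exp \<kappa> * (\<integral>x\<in>A. cosh (norm (U i x)) \<partial>M)" .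
    have "(\<integral>x\<in>A. W (Suc i) x \<partial>M) = exp (- (\<kappa> * real (Suc i))) * (\<integral>x\<in>A. cosh (norm (U (Suc i) x)) \<partial>M)"
      unfolding W_def by (rule set_integral_mult_right)
    also have "\<dots> \<le> exp (- (\<kappa> * real (Suc i))) * (exp \<kappa> * (\<integral>x\<in>A. cosh (norm (U i x)) \<partial>M))"
      using le by (rule mult_left_mono) simp
    also have "\<dots> = exp (- (\<kappa> * real i)) * (\<integral>x\<in>A. cosh (norm (U i x)) \<partial>M)"
      by (simp add: mult.assoc[symmetric] exp_add[symmetric] algebra_simps)
    also have "\<dots> = (\<integral>x\<in>A. W i x \<partial>M)"
      unfolding W_def by (rule set_integral_mult_right[symmetric])
    finally show ?thesis .
  qed
  have "1 / \<alpha> * measure M {x \<in> space M. \<exists>i\<le>N. 1 / \<alpha> \<le> W i x} \<le> (\<integral>x. W 0 x \<partial>M)"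
    by (rule supermartingale_maximal[where G = G and W = W, OF fin sub mono W_meas W_int W_nonneg step])
  also have "\<dots> = 1" by (simp add: W_def U_def S_def prob_space)
  finally have max: "measure M {x \<in> space M. \<exists>i\<le>N. 1 / \<alpha> \<le> W i x} \<le> \<alpha>"
    using \<alpha> by (simp add: field_simps)
  have [measurable]: "W n \<in> borel_measurable M" for n by (rule measurable_from_subalg[OF sub W_meas])
  have fold: "(\<Sum>i<n. T i x - D i x) = S n x" for n x by (simp add: S_def)
  show "{x \<in> space M. \<exists>n\<le>N. \<beta> * ln (2 / \<alpha>) + \<beta> * \<kappa> * real n \<le> norm (\<Sum>i<n. T i x - D i x)} \<in> sets M"
    unfolding fold by measurable
  have "1 / \<alpha> \<le> W n x" if "\<beta> * ln (2 / \<alpha>) + \<beta> * \<kappa> * real n \<le> norm (S n x)" for n x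
  proof -
    have "ln (2 / \<alpha>) + \<kappa> * real n \<le> norm (U n x)"
    proof -
      have "(\<beta> * ln (2 / \<alpha>) + \<beta> * \<kappa> * real n) / \<beta> \<le> norm (S n x) / \<beta>"
        using that beta by (intro divide_right_mono) auto
      then show ?thesis using beta by (simp add: U_def add_divide_distrib)
    qed
    then have "exp (ln (2 / \<alpha>) + \<kappa> * real n) \<le> exp (norm (U n x))" by simp
    then have "2 / \<alpha> * exp (\<kappa> * real n) \<le> exp (norm (U n x))" using \<alpha> by (simp add: exp_add)
    \<comment> \<open>The factor 2 lost here is the numerator in
      \<open>ln (2 / \<alpha>)\<close>.\<close>
    also have "\<dots> \<le> 2 * cosh (norm (U n x))" by (simp add: cosh_field_def)
    finally have "1 / \<alpha> * exp (\<kappa> * real n) \<le> cosh (norm (U n x))" by simp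
    then have "exp (- (\<kappa> * real n)) * (1 / \<alpha> * exp (\<kappa> * real n)) \<le> W n x"
      unfolding W_def by (intro mult_left_mono) auto
    then show ?thesis by (simp add: exp_minus)
  qed
  then have "measure M {x \<in> space M. \<exists>n\<le>N. \<beta> * ln (2 / \<alpha>) + \<beta> * \<kappa> * real n \<le> norm (\<Sum>i<n. T i x - D i x)}
      \<le> measure M {x \<in> space M. \<exists>i\<le>N. 1 / \<alpha> \<le> W i x}"
    unfolding fold by (intro finite_measure_mono) auto
  with max show "measure M {x \<in> space M. \<exists>n\<le>N. \<beta> * ln (2 / \<alpha>) + \<beta> * \<kappa> * real n \<le> norm (\<Sum>i<n. T i x - D i x)} \<le> \<alpha>"
    by simp
qed

subsection \<open>Truncation and rates\<close>

lemma K_const_pos: "1 < p \<Longrightarrow> 0 < K_const p"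
  by (simp add: K_const_def)

lemma C_space_pos: "0 < \<beta> \<Longrightarrow> 0 < C_space p \<beta> T"
proof -
  assume "0 < \<beta>"
  then have "0 < (2 / \<beta>)\<^sup>2 / 2" "1 + 2 / \<beta> + (2 / \<beta>)\<^sup>2 / 2 \<le> exp (2 / \<beta>)"
    by (auto intro!: exp_lower_Taylor_quadratic)
  then have "0 < exp (2 / \<beta>) - 2 / \<beta> - 1" by linarith
  with \<open>0 < \<beta>\<close> show ?thesis unfolding C_space_def by (intro mult_pos_pos divide_pos_pos) auto
qed

text \<open>\<open>K_const p\<close> is the maximum of \<open>(t - 1) / t powr p\<close>, attained at \<open>t = p / (p - 1)\<close>.\<close>

lemma diff_one_le_K_const:
  fixes t p :: real
  assumes "1 < p" "0 \<le> t"
  shows "t - 1 \<le> K_const p * t powr p"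
proof -
  \<comment> \<open>The maximizer is also the conjugate exponent of \<open>p\<close>; Young's
    inequality for \<open>t / t0\<close> and 1 is an equality exactly at
    \<open>t = t0\<close>.\<close>
  define t0 where "t0 = p / (p - 1)"
  have t0: "t0 > 0" "t0 > 1" "1 / p + 1 / t0 = 1" using assms by (auto simp: t0_def field_simps)
  have "(t / t0) * 1 \<le> (t / t0) powr p / p + 1 powr t0 / t0"
    using assms t0 by (intro Youngs_inequality) auto
  then have "p * (t / t0) \<le> p * ((t / t0) powr p / p + 1 / t0)"
    using assms by (intro mult_left_mono) auto
  also have "\<dots> = (t / t0) powr p + p / t0" using assms by (simp add: distrib_left)
  also have "p / t0 = p - 1" using assms by (simp add: t0_def)
  finally have "p * (t / t0) - (p - 1) \<le> (t / t0) powr p" by simp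
  moreover have "p * (t / t0) = (p - 1) * t" using assms by (simp add: t0_def)
  moreover have "(t / t0) powr p = t powr p / t0 powr p" by (rule powr_divide)
  ultimately have "(p - 1) * t - (p - 1) \<le> t powr p / t0 powr p" by simp
  then have "(t - 1) * (p - 1) \<le> t powr p / t0 powr p" by (simp add: algebra_simps)
  then have "t - 1 \<le> t powr p / t0 powr p / (p - 1)"
    using assms by (subst pos_le_divide_eq) auto
  also have "\<dots> = K_const p * t powr p"
  proof -
    have "(p - 1) * t0 powr p = p * t0 powr (p - 1)"
      using t0 assms powr_mult_base[of t0 "p - 1"] by (simp add: t0_def field_simps)
    moreover have "((p - 1) / p) powr (p - 1) = 1 / t0 powr (p - 1)"
      using assms by (simp add: t0_def powr_divide)
    ultimately show ?thesis by (simp add: K_const_def mult.commute)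
  qed
  finally show ?thesis .
qed

lemma powr_add_le:
  fixes x y p :: real
  assumes "1 \<le> p" "0 \<le> x" "0 \<le> y"
  shows "(x + y) powr p \<le> 2 powr (p - 1) * (x powr p + y powr p)"
proof -
  have one: "1 \<le> 2 powr (p - 1)" using assms by (simp add: ge_one_powr_ge_zero)
  consider "x = 0" | "y = 0" | "0 < x" "0 < y" using assms by linarith
  then show ?thesis
  proof cases
    case 1
    then show ?thesis using mult_right_mono[OF one, of "y powr p"] by simp
  next
    case 2
    then show ?thesis using mult_right_mono[OF one, of "x powr p"] by simp
  next
    case 3
    have "((1 - 1/2) *\<^sub>R x + (1/2) *\<^sub>R y) powr p \<le> (1 - 1/2) * x powr p + (1/2) * y powr p"
      using 3 powr_convex[OF assms(1)] by (intro convex_onD) auto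
    then have "((x + y) / 2) powr p \<le> (x powr p + y powr p) / 2" by (simp add: add_divide_distrib)
    then have "(x + y) powr p / 2 powr p \<le> (x powr p + y powr p) / 2"
      using 3 by (simp add: powr_divide)
    then have "(x + y) powr p \<le> 2 powr p * ((x powr p + y powr p) / 2)"
      by (simp add: field_simps)
    then show ?thesis by (simp add: powr_diff)
  qed
qed

text \<open>With \<open>t = lam * norm y\<close> the truncated vector has norm
  \<open>min t 1\<close>. For \<open>p \<le> 2\<close> its square is at most
  \<open>t powr p\<close>, and the excess of \<open>t\<close> over 1 that is cut off is at most
  \<open>K_const p * t powr p\<close>, so one moment governs both variance and bias.\<close>

lemma
  fixes y :: "'b::real_normed_vector"
  assumes lam: "0 < lam" and p: "1 < p" "p \<le> 2"
  shows norm_Trunc_le: "norm ((lam * Trunc (lam *\<^sub>R y)) *\<^sub>R y) \<le> 1"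
    and norm_Trunc_sq_le: "(norm ((lam * Trunc (lam *\<^sub>R y)) *\<^sub>R y))\<^sup>2 \<le> lam powr p * norm y powr p"
    and norm_Trunc_diff_le:
      "norm ((lam * Trunc (lam *\<^sub>R y)) *\<^sub>R y - lam *\<^sub>R y) \<le> K_const p * (lam powr p * norm y powr p)"
proof -
  define t where "t = lam * norm y"
  have t0: "t \<ge> 0" using lam by (simp add: t_def)
  have tp: "lam powr p * norm y powr p = t powr p" using lam by (simp add: t_def powr_mult)
  have tr: "Trunc (lam *\<^sub>R y) * t = min t 1" "0 \<le> Trunc (lam *\<^sub>R y)"
    using lam by (auto simp: Trunc_def t_def min_def field_simps)
  have eq: "norm ((lam * Trunc (lam *\<^sub>R y)) *\<^sub>R y) = min t 1"
    using tr lam by (simp add: t_def abs_mult mult_ac)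
  have sq: "(min t 1)\<^sup>2 \<le> t powr p"
  proof (cases "t \<le> 1")
    case True
    have "t\<^sup>2 = t powr 2 \<or> t = 0" using t0 by (auto simp: less_le)
    moreover have "t powr 2 \<le> t powr p" using True t0 p by (intro powr_mono') auto
    ultimately show ?thesis using True by auto
  next
    case False
    then show ?thesis using p by (simp add: ge_one_powr_ge_zero)
  qed
  show "norm ((lam * Trunc (lam *\<^sub>R y)) *\<^sub>R y) \<le> 1" using eq by simp
  show "(norm ((lam * Trunc (lam *\<^sub>R y)) *\<^sub>R y))\<^sup>2 \<le> lam powr p * norm y powr p"
    unfolding eq tp by (rule sq)
  have "(lam * Trunc (lam *\<^sub>R y)) *\<^sub>R y - lam *\<^sub>R y = (lam * Trunc (lam *\<^sub>R y) - lam) *\<^sub>R y"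
    by (simp add: scaleR_left_diff_distrib)
  also have "norm \<dots> = \<bar>(lam * Trunc (lam *\<^sub>R y) - lam) * norm y\<bar>" by (simp add: abs_mult)
  also have "(lam * Trunc (lam *\<^sub>R y) - lam) * norm y = Trunc (lam *\<^sub>R y) * t - t"
    by (simp add: t_def algebra_simps)
  also have "\<bar>Trunc (lam *\<^sub>R y) * t - t\<bar> = \<bar>min t 1 - t\<bar>" by (simp only: tr)
  also have "\<dots> \<le> K_const p * t powr p"
    using diff_one_le_K_const[OF p(1) t0] K_const_pos[OF p(1)] by (auto simp: min_def)
  finally show "norm ((lam * Trunc (lam *\<^sub>R y)) *\<^sub>R y - lam *\<^sub>R y) \<le> K_const p * (lam powr p * norm y powr p)"
    unfolding tp .
qed

lemma borel_measurable_Trunc[measurable]: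
  "Trunc \<in> borel_measurable (borel :: 'b::{real_normed_vector, second_countable_topology} measure)"
  unfolding Trunc_def by measurable

text \<open>Balancing the two error terms at \<open>lam = (L / (J * (Q * g))) powr (1 / p)\<close>; the block length
  \<open>J\<close> and the effective sample size \<open>l\<close> differ by at most a factor two either way.\<close>

lemma balanced_rate_le:
  fixes L J Q g l p lam :: real
  assumes pos: "0 < L" "0 < J" "0 < Q" "0 < g" "0 < l" and p: "1 < p"
    and lJ: "l \<le> 2 * J" "J \<le> 2 * l"
    and lam: "lam = (L / (J * (Q * g))) powr (1 / p)"
  shows "L / (lam * l) + lam powr (p - 1) * (Q * g)
    \<le> (2 powr ((p - 1) / p) + 2 powr (1 / p)) * Q powr (1 / p) * g powr (1 / p) * (L / l) powr ((p - 1) / p)"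
proof -
  define a G where aG: "a = 1 / p" "G = Q * g"
  have a: "0 < a" "a < 1" "(p - 1) / p = 1 - a" using p by (auto simp: aG field_simps)
  have G: "0 < G" using pos by (simp add: aG)
  have lam_pos: "0 < lam" using pos by (simp add: lam)
  \<comment> \<open>The deviation term equals \<open>(J / l) powr a * B\<close> and the bias term
    \<open>(l / J) powr (1 - a) * B\<close>. The hypotheses \<open>J \<le> 2 * l\<close> and
    \<open>l \<le> 2 * J\<close> turn these into the two powers of 2.\<close>
  define B where "B = G powr a * (L / l) powr (1 - a)"
  have B: "0 \<le> B" by (simp add: B_def)
  have "lam * ((J / l) powr a * B) = L / l"
  proof -
    have "lam * (J / l) powr a * G powr a = (L / (J * G) * (J / l)) powr a * G powr a"
      unfolding lam aG(1) aG(2)[symmetric] by (simp only: powr_mult)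
    also have "\<dots> = (L / (J * G) * (J / l) * G) powr a"
      by (rule powr_mult[symmetric])
    also have "L / (J * G) * (J / l) * G = L / l" using pos G by simp
    finally have "lam * ((J / l) powr a * B) = (L / l) powr a * (L / l) powr (1 - a)"
      by (simp add: B_def mult.assoc)
    also have "\<dots> = (L / l) powr 1" by (simp flip: powr_add)
    finally show ?thesis using pos by simp
  qed
  then have "L / (lam * l) = (J / l) powr a * B"
    using lam_pos pos by (simp add: field_simps)
  also have "\<dots> \<le> 2 powr a * B"
    using pos lJ a B by (intro mult_right_mono powr_mono2) (auto simp: field_simps)
  finally have 1: "L / (lam * l) \<le> 2 powr a * B" .
  have "lam powr (p - 1) * G = (L / (J * G)) powr (1 - a) * (G powr (1 - a) * G powr a)"
  proof -
    have "lam powr (p - 1) = (L / (J * G)) powr (1 - a)"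
      using p by (simp add: lam aG powr_powr field_simps)
    moreover have "G = G powr (1 - a) * G powr a" using G by (simp flip: powr_add)
    ultimately show ?thesis by simp
  qed
  also have "\<dots> = (L / (J * G) * G) powr (1 - a) * G powr a"
    by (simp only: powr_mult mult.assoc)
  also have "L / (J * G) * G = (l / J) * (L / l)" using pos G by simp
  also have "((l / J) * (L / l)) powr (1 - a) * G powr a = (l / J) powr (1 - a) * B"
    using pos by (simp only: powr_mult B_def) simp
  also have "\<dots> \<le> 2 powr (1 - a) * B"
    using pos lJ a B by (intro mult_right_mono powr_mono2) (auto simp: field_simps)
  finally have 2: "lam powr (p - 1) * G \<le> 2 powr (1 - a) * B" .
  have "L / (lam * l) + lam powr (p - 1) * G \<le> (2 powr (1 - a) + 2 powr a) * B"
    using 1 2 by (simp add: algebra_simps)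
  also have "B = Q powr a * g powr a * (L / l) powr (1 - a)"
    using pos by (simp add: B_def aG powr_mult)
  finally show ?thesis unfolding a(3) by (simp add: aG mult.assoc)
qed

lemma flog2_bounds:
  assumes "2 \<le> n"
  shows "2 ^ flog2 n \<le> n" "n < 2 ^ Suc (flog2 n)" "1 \<le> flog2 n" "flog2 n \<le> n"
proof -
  have n: "real n > 0" "1 \<le> log 2 (real n)" using assms by (auto simp: le_log_iff)
  have j: "real (flog2 n) = of_int \<lfloor>log 2 (real n)\<rfloor>" using n by (simp add: flog2_def)
  then have le: "real (flog2 n) \<le> log 2 (real n)" "log 2 (real n) < real (flog2 n) + 1" by linarith+
  from le(1) have "2 powr real (flog2 n) \<le> real n" using n by (simp add: le_log_iff)
  then have "real (2 ^ flog2 n) \<le> real n" by (simp add: powr_realpow)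
  then show *: "2 ^ flog2 n \<le> n" by linarith
  from le(2) have "real n < 2 powr (real (flog2 n) + 1)" using n by (simp add: log_less_iff)
  then have "real n < real (2 ^ Suc (flog2 n))" by (simp add: powr_add powr_realpow)
  then show "n < 2 ^ Suc (flog2 n)" by linarith
  show "1 \<le> flog2 n" using n by (simp add: flog2_def le_nat_iff le_floor_iff)
  show "flog2 n \<le> n" using * less_exp[of "flog2 n"] by linarith
qed

subsection \<open>Uniform bound over one block\<close>

text \<open>The hypothesis lives in the extended nonnegative reals, so integrability is a
  conclusion: integration over the whole space gives a finite moment.\<close>

lemma moment_set_integral_le:
  fixes X :: "'a \<Rightarrow> 'b::{banach, second_countable_topology}"
  assumes prob: "prob_space M" and sfs: "sigma_finite_subalgebra M F"
    and X[measurable]: "X \<in> borel_measurable M" and v: "0 \<le> v"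
    and moment: "AE \<omega> in M. nn_cond_exp M F (\<lambda>\<omega>. ennreal (norm (X \<omega> - \<mu>) powr p)) \<omega> \<le> ennreal v"
  shows "integrable M (\<lambda>\<omega>. norm (X \<omega> - \<mu>) powr p)"
    and "A \<in> sets F \<Longrightarrow> (\<integral>\<omega>\<in>A. norm (X \<omega> - \<mu>) powr p \<partial>M) \<le> v * measure M A"
proof -
  interpret prob_space M by fact
  interpret sigma_finite_subalgebra M F by fact
  have le: "(\<integral>\<^sup>+\<omega>. indicator A \<omega> * ennreal (norm (X \<omega> - \<mu>) powr p) \<partial>M) \<le> ennreal (v * measure M A)"
    if A: "A \<in> sets F" for A
  proof -
    have [measurable]: "A \<in> sets M" using A subalg by (auto simp: subalgebra_def)
    have "(\<integral>\<^sup>+\<omega>. indicator A \<omega> * ennreal (norm (X \<omega> - \<mu>) powr p) \<partial>M)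
        = (\<integral>\<^sup>+\<omega>. indicator A \<omega> * nn_cond_exp M F (\<lambda>\<omega>. ennreal (norm (X \<omega> - \<mu>) powr p)) \<omega> \<partial>M)"
      by (rule nn_cond_exp_intg[symmetric]) (use A in measurable)
    also have "\<dots> \<le> (\<integral>\<^sup>+\<omega>. indicator A \<omega> * ennreal v \<partial>M)"
      by (intro nn_integral_mono_AE) (use moment in eventually_elim, auto intro: mult_left_mono)
    also have "\<dots> = ennreal (v * measure M A)"
      using v by (subst nn_integral_multc) (auto simp: emeasure_eq_measure ennreal_mult' mult.commute)
    finally show ?thesis .
  qed
  have "(\<integral>\<^sup>+\<omega>. ennreal (norm (X \<omega> - \<mu>) powr p) \<partial>M) = (\<integral>\<^sup>+\<omega>. indicator (space F) \<omega> * ennreal (norm (X \<omega> - \<mu>) powr p) \<partial>M)"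
    using subalg by (intro nn_integral_cong) (auto simp: subalgebra_def)
  also have "\<dots> < \<infinity>" using le_less_trans[OF le[of "space F"]] by simp
  finally show int: "integrable M (\<lambda>\<omega>. norm (X \<omega> - \<mu>) powr p)"
    by (intro integrableI_nonneg) auto
  assume A: "A \<in> sets F"
  then have AM[measurable]: "A \<in> sets M" using subalg by (auto simp: subalgebra_def)
  have "ennreal (\<integral>\<omega>\<in>A. norm (X \<omega> - \<mu>) powr p \<partial>M) = (\<integral>\<^sup>+\<omega>. ennreal (indicator A \<omega> * norm (X \<omega> - \<mu>) powr p) \<partial>M)"
    unfolding set_lebesgue_integral_def using integrable_mult_indicator[OF AM int]
    by (subst nn_integral_eq_integral) auto
  also have "\<dots> \<le> ennreal (v * measure M A)"
    using le[OF A] by (simp add: ennreal_mult' ennreal_indicator)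
  finally show "(\<integral>\<omega>\<in>A. norm (X \<omega> - \<mu>) powr p \<partial>M) \<le> v * measure M A"
    using v by (subst (asm) ennreal_le_iff) auto
qed

text \<open>The conditional Jensen inequality bounds a version almost everywhere; resetting it to 0
  on the exceptional set, which lies in \<open>F\<close>, bounds it everywhere, as
  \<open>martingale_tail\<close> expects.\<close>

lemma is_cond_exp_bounded_exists:
  fixes f :: "'a \<Rightarrow> 'b::{banach, second_countable_topology}"
  assumes smooth: "beta_smooth \<beta> TYPE('b)" and fin: "finite_measure M"
    and sfs: "sigma_finite_subalgebra M F"
    and f: "f \<in> borel_measurable M" "\<And>x. x \<in> space M \<Longrightarrow> norm (f x) \<le> K" and K: "0 \<le> K"
  shows "\<exists>D. is_cond_exp M F f D \<and> (\<forall>x. norm (D x) \<le> K)"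
proof -
  interpret finite_measure M by fact
  interpret sigma_finite_subalgebra M F by fact
  have fi: "integrable M f" using f by (intro integrable_const_bound[of _ K]) auto
  obtain D where D: "is_cond_exp M F f D" using is_cond_exp_exists[OF smooth sfs fi] by blast
  have Di: "integrable M D" and DF[measurable]: "D \<in> borel_measurable F" using D by (auto simp: is_cond_exp_def)
  have AE: "AE x in M. norm (D x) \<le> K"
  proof (rule AE_le_of_set_integral_le[OF fin subalg])
    fix A assume A: "A \<in> sets F"
    then have AM: "A \<in> sets M" using subalg by (auto simp: subalgebra_def)
    have "(\<integral>x\<in>A. norm (D x) \<partial>M) \<le> (\<integral>x\<in>A. norm (f x) \<partial>M)"
      by (rule is_cond_exp_norm_le[OF smooth subalg D A])
    also have "\<dots> \<le> (\<integral>x. indicator A x *\<^sub>R K \<partial>M)"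
      unfolding set_lebesgue_integral_def using f(2) fi AM
      by (intro integral_mono integrable_mult_indicator) (auto simp: indicator_def)
    also have "\<dots> = K * measure M A" using AM by simp
    finally show "(\<integral>x\<in>A. norm (D x) \<partial>M) \<le> K * measure M A" .
  qed (use Di in auto)
  define E where "E = (\<lambda>x. if norm (D x) \<le> K then D x else 0)"
  have EF[measurable]: "E \<in> borel_measurable F" unfolding E_def by measurable
  have EM[measurable]: "E \<in> borel_measurable M" by (rule measurable_from_subalg[OF subalg EF])
  have DM[measurable]: "D \<in> borel_measurable M" using Di by auto
  have eq: "AE x in M. D x = E x" using AE by eventually_elim (simp add: E_def)
  have Ei: "integrable M E" using integrable_cong_AE[OF DM EM eq] Di by simp
  have "(\<integral>x\<in>A. D x \<partial>M) = (\<integral>x\<in>A. E x \<partial>M)" if "A \<in> sets F" for A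
  proof -
    have [measurable]: "A \<in> sets M" using that subalg by (auto simp: subalgebra_def)
    show ?thesis unfolding set_lebesgue_integral_def
      by (rule integral_cong_AE) (use eq in \<open>auto elim: eventually_mono\<close>)
  qed
  then have "is_cond_exp M F f E" using D Ei EF by (auto simp: is_cond_exp_def)
  moreover have "norm (E x) \<le> K" for x using K by (auto simp: E_def)
  ultimately show ?thesis by blast
qed

text \<open>Sample splitting: \<open>Z\<close> is determined at time \<open>k\<close> and only later
  observations enter the sum, so conditionally \<open>Z\<close> acts as a constant. The bad set
  unites a large martingale deviation and an inaccurate pilot, at cost \<alpha> each, with a null
  set.\<close>

lemma block_bound:
  fixes X :: "nat \<Rightarrow> 'a \<Rightarrow> 'b::{banach, second_countable_topology}"
  assumes prob: "prob_space M"
    and smooth: "beta_smooth \<beta> TYPE('b)" and beta: "\<beta> > 0"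
    and sfs: "\<And>n. sigma_finite_subalgebra M (F n)"
    and mono: "\<And>n m. n \<le> m \<Longrightarrow> sets (F n) \<subseteq> sets (F m)"
    and adapted: "\<And>n. n \<ge> 1 \<Longrightarrow> X n \<in> borel_measurable (F n)"
    and mean_int: "\<And>n. n \<ge> 1 \<Longrightarrow> integrable M (X n)"
    and mean: "\<And>n A. n \<ge> 1 \<Longrightarrow> A \<in> sets (F (n - 1)) \<Longrightarrow>
                 set_lebesgue_integral M A (X n) = measure M A *\<^sub>R \<mu>"
    and p: "1 < p" "p \<le> 2"
    and v: "v > 0"
    and moment: "AE \<omega> in M. \<forall>n\<ge>1.
                 nn_cond_exp M (F (n - 1)) (\<lambda>\<omega>. ennreal (norm (X n \<omega> - \<mu>) powr p)) \<omega> \<le> ennreal v"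
    and Z: "Z \<in> borel_measurable (F k)"
    and R: "0 < R" "measure M {\<omega> \<in> space M. R \<le> norm (Z \<omega> - \<mu>)} \<le> \<alpha>"
    and lam: "0 < lam" and \<alpha>: "0 < \<alpha>"
  shows "\<exists>G\<in>sets M. measure M G \<le> 2 * \<alpha> \<and> (\<forall>\<omega>\<in>space M - G. \<forall>n. k < n \<and> n \<le> N \<longrightarrow>
     norm (muhat_est X (Z \<omega>) lam k n \<omega> - \<mu>) \<le> \<beta> * ln (2 / \<alpha>) / (lam * (real n - real k))
       + lam powr (p - 1) * ((\<beta> * C_space p \<beta> TYPE('b) + 2 powr (p - 1) * K_const p) * (v + R powr p)))"
proof -
  interpret prob_space M by fact
  have fin: "finite_measure M" by unfold_locales
  have sub: "subalgebra M (F i)" for i using sfs by (simp add: sigma_finite_subalgebra_def)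
  have sub': "subalgebra (F j) (F i)" if "i \<le> j" for i j
    using sub mono[OF that] by (auto simp: subalgebra_def)
  have sets_M: "A \<in> sets M" if "A \<in> sets (F i)" for A i using that sub by (auto simp: subalgebra_def)
  define H where "H = (\<lambda>i. F (k + i))"
  define B where "B = {\<omega> \<in> space M. norm (Z \<omega> - \<mu>) < R}"
  have BF: "B \<in> sets (F (k + i))" for i
  proof -
    have "{\<omega> \<in> space (F k). norm (Z \<omega> - \<mu>) < R} \<in> sets (F k)" using Z by measurable
    then show ?thesis using sub[of k] mono[of k "k + i"] by (auto simp: B_def subalgebra_def)
  qed
  have BM[measurable]: "B \<in> sets M" using sets_M[OF BF] .
  have XM[measurable]: "X (Suc i) \<in> borel_measurable M" for i
    by (rule measurable_from_subalg[OF sub adapted]) simp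
  have ZM[measurable]: "Z \<in> borel_measurable M" by (rule measurable_from_subalg[OF sub Z])
  define Y where "Y = (\<lambda>i \<omega>. X (Suc (k + i)) \<omega> - Z \<omega>)"
  have YM[measurable]: "Y i \<in> borel_measurable M" for i unfolding Y_def by measurable
  \<comment> \<open>The indicator of \<open>B\<close> makes the conditional moment bounds
    deterministic, and on \<open>B\<close> it changes nothing.\<close>
  define T where "T = (\<lambda>i \<omega>. indicat_real B \<omega> *\<^sub>R ((lam * Trunc (lam *\<^sub>R Y i \<omega>)) *\<^sub>R Y i \<omega>))"
  define Q where "Q = (\<lambda>i \<omega>. indicat_real B \<omega> *\<^sub>R (lam *\<^sub>R Y i \<omega>))"
  \<comment> \<open>The conditional mean of the untruncated increment \<open>Q i\<close>. It is the
    same for every \<open>i\<close> and is the centre from which the bias of truncation is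
    measured.\<close>
  define c where "c = (\<lambda>\<omega>. indicat_real B \<omega> *\<^sub>R (lam *\<^sub>R (\<mu> - Z \<omega>)))"
  define U where "U = (\<lambda>i \<omega>. indicat_real B \<omega> * (lam powr p * norm (Y i \<omega>) powr p))"
  define V where "V = 2 powr (p - 1) * lam powr p * (v + R powr p)"
  define b where "b = K_const p * V"
  have V0: "0 \<le> V" using v by (simp add: V_def)
  have T_meas: "T i \<in> borel_measurable (H (Suc i))" for i
  proof -
    have [measurable]: "X (Suc (k + i)) \<in> borel_measurable (F (Suc (k + i)))" by (rule adapted) simp
    have [measurable]: "Z \<in> borel_measurable (F (Suc (k + i)))"
      by (rule measurable_from_subalg[OF sub' Z]) simp
    have [measurable]: "B \<in> sets (F (Suc (k + i)))" using BF[of "Suc i"] by simp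
    show ?thesis unfolding T_def H_def Y_def by simp
  qed
  have TM[measurable]: "T i \<in> borel_measurable M" for i
    using measurable_from_subalg[OF sub T_meas[unfolded H_def]] .
  have T1: "norm (T i \<omega>) \<le> 1" for i \<omega>
    using norm_Trunc_le[OF lam p, of "Y i \<omega>"] by (auto simp: T_def indicator_def)
  have mom: "integrable M (\<lambda>\<omega>. norm (X (Suc (k + i)) \<omega> - \<mu>) powr p)"
    "A \<in> sets (F (k + i)) \<Longrightarrow> (\<integral>\<omega>\<in>A. norm (X (Suc (k + i)) \<omega> - \<mu>) powr p \<partial>M) \<le> v * measure M A" for i A
  proof -
    have "AE \<omega> in M. nn_cond_exp M (F (k + i)) (\<lambda>\<omega>. ennreal (norm (X (Suc (k + i)) \<omega> - \<mu>) powr p)) \<omega> \<le> ennreal v"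
      using moment by eventually_elim (metis diff_Suc_1 le_add1 plus_1_eq_Suc)
    note * = moment_set_integral_le[OF prob sfs XM less_imp_le[OF v] this]
    show "integrable M (\<lambda>\<omega>. norm (X (Suc (k + i)) \<omega> - \<mu>) powr p)" by (rule *(1))
    show "A \<in> sets (F (k + i)) \<Longrightarrow> (\<integral>\<omega>\<in>A. norm (X (Suc (k + i)) \<omega> - \<mu>) powr p \<partial>M) \<le> v * measure M A"
      by (rule *(2))
  qed
  have U_le: "U i \<omega> \<le> 2 powr (p - 1) * lam powr p * (norm (X (Suc (k + i)) \<omega> - \<mu>) powr p + R powr p)" for i \<omega>
  proof (cases "\<omega> \<in> B")
    case True
    have "norm (Y i \<omega>) \<le> norm (X (Suc (k + i)) \<omega> - \<mu>) + norm (Z \<omega> - \<mu>)"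
      using norm_triangle_ineq4[of "X (Suc (k + i)) \<omega> - \<mu>" "Z \<omega> - \<mu>"] by (simp add: Y_def)
    then have "norm (Y i \<omega>) \<le> norm (X (Suc (k + i)) \<omega> - \<mu>) + R" using True by (simp add: B_def)
    then have "norm (Y i \<omega>) powr p \<le> (norm (X (Suc (k + i)) \<omega> - \<mu>) + R) powr p"
      using p by (intro powr_mono2) auto
    also have "\<dots> \<le> 2 powr (p - 1) * (norm (X (Suc (k + i)) \<omega> - \<mu>) powr p + R powr p)"
      using p R by (intro powr_add_le) auto
    finally have "lam powr p * norm (Y i \<omega>) powr p
        \<le> lam powr p * (2 powr (p - 1) * (norm (X (Suc (k + i)) \<omega> - \<mu>) powr p + R powr p))"
      by (intro mult_left_mono) auto
    then show ?thesis using True by (simp add: U_def mult_ac)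
  qed (simp add: U_def)
  have U0: "0 \<le> U i \<omega>" for i \<omega> by (simp add: U_def)
  have dom: "integrable M (\<lambda>\<omega>. 2 powr (p - 1) * lam powr p * (norm (X (Suc (k + i)) \<omega> - \<mu>) powr p + R powr p))" for i
    using mom(1) by auto
  have U_int: "integrable M (U i)" for i
  proof (rule Bochner_Integration.integrable_bound[OF dom[of i]])
    show "U i \<in> borel_measurable M" unfolding U_def by measurable
    show "AE \<omega> in M. norm (U i \<omega>) \<le> norm (2 powr (p - 1) * lam powr p * (norm (X (Suc (k + i)) \<omega> - \<mu>) powr p + R powr p))"
      using U_le[of i] U0[of i] by (intro AE_I2) (auto intro: order_trans[OF _ abs_ge_self])
  qed
  have si: "integrable M (\<lambda>\<omega>. indicator A \<omega> * h \<omega>)" if "A \<in> sets (F i)" "integrable M h" for A i and h :: "'a \<Rightarrow> real"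
    using integrable_mult_indicator[OF sets_M[OF that(1)] that(2)] by simp
  have U_le_V: "(\<integral>\<omega>\<in>A. U i \<omega> \<partial>M) \<le> V * measure M A" if A: "A \<in> sets (F (k + i))" for A i
  proof -
    let ?C = "2 powr (p - 1) * lam powr p"
    have i1: "integrable M (\<lambda>\<omega>. indicator A \<omega> * norm (X (Suc (k + i)) \<omega> - \<mu>) powr p)"
      and i2: "integrable M (\<lambda>\<omega>. indicator A \<omega> * R powr p)"
      using si[OF A mom(1)] si[OF A integrable_const] by auto
    have "(\<integral>\<omega>\<in>A. U i \<omega> \<partial>M)
        \<le> (\<integral>\<omega>. ?C * (indicator A \<omega> * norm (X (Suc (k + i)) \<omega> - \<mu>) powr p + indicator A \<omega> * R powr p) \<partial>M)"
      unfolding set_lebesgue_integral_def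
    proof (rule integral_mono)
      show "integrable M (\<lambda>\<omega>. indicat_real A \<omega> *\<^sub>R U i \<omega>)" using si[OF A U_int] by simp
      show "integrable M (\<lambda>\<omega>. ?C * (indicator A \<omega> * norm (X (Suc (k + i)) \<omega> - \<mu>) powr p + indicator A \<omega> * R powr p))"
        using i1 i2 by (intro integrable_mult_right Bochner_Integration.integrable_add)
      show "indicat_real A \<omega> *\<^sub>R U i \<omega>
          \<le> ?C * (indicator A \<omega> * norm (X (Suc (k + i)) \<omega> - \<mu>) powr p + indicator A \<omega> * R powr p)" for \<omega>
        using U_le[of i \<omega>] by (auto simp: indicator_def)
    qed
    also have "\<dots> = ?C * ((\<integral>\<omega>\<in>A. norm (X (Suc (k + i)) \<omega> - \<mu>) powr p \<partial>M) + R powr p * measure M A)"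
      using i1 i2 sets_M[OF A] by (simp add: set_lebesgue_integral_def)
    also have "\<dots> \<le> ?C * (v * measure M A + R powr p * measure M A)"
      using mom(2)[OF A] by (intro mult_left_mono) auto
    finally show ?thesis by (simp add: V_def algebra_simps)
  qed
  \<comment> \<open>Used with \<open>C = 1\<close> for the second moment of \<open>T\<close> and
    with \<open>C = K_const p\<close> for the bias.\<close>
  have bound_int: "(\<integral>\<omega>\<in>A. g \<omega> \<partial>M) \<le> C * (V * measure M A)"
    if A: "A \<in> sets (F (k + i))" and g: "integrable M g" "\<And>\<omega>. g \<omega> \<le> C * U i \<omega>" and C: "0 \<le> C" for A i C and g :: "'a \<Rightarrow> real"
  proof -
    have "(\<integral>\<omega>\<in>A. g \<omega> \<partial>M) \<le> (\<integral>\<omega>\<in>A. C * U i \<omega> \<partial>M)"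
      using si[OF A g(1)] si[OF A integrable_mult_right[OF U_int]] g(2) unfolding set_lebesgue_integral_def
      by (intro integral_mono) (auto intro: mult_left_mono)
    also have "\<dots> = C * (\<integral>\<omega>\<in>A. U i \<omega> \<partial>M)" by (rule set_integral_mult_right)
    also have "\<dots> \<le> C * (V * measure M A)" using U_le_V[OF A] C by (intro mult_left_mono)
    finally show ?thesis .
  qed
  have T_int: "integrable M (T i)" for i by (rule integrable_const_bound[of _ 1]) (use T1 in auto)
  have T_sq: "(\<integral>\<omega>\<in>A. (norm (T i \<omega>))\<^sup>2 \<partial>M) \<le> V * measure M A" if A: "A \<in> sets (H i)" for A i
  proof -
    have "(\<integral>\<omega>\<in>A. (norm (T i \<omega>))\<^sup>2 \<partial>M) \<le> 1 * (V * measure M A)"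
    proof (rule bound_int)
      show "A \<in> sets (F (k + i))" using A by (simp add: H_def)
      show "integrable M (\<lambda>\<omega>. (norm (T i \<omega>))\<^sup>2)"
        by (rule integrable_const_bound[of _ 1]) (use T1 in \<open>auto simp: power_le_one\<close>)
      show "(norm (T i \<omega>))\<^sup>2 \<le> 1 * U i \<omega>" for \<omega>
        using norm_Trunc_sq_le[OF lam p, of "Y i \<omega>"] by (auto simp: T_def U_def indicator_def)
    qed simp
    then show ?thesis by simp
  qed
  have cF: "c \<in> borel_measurable (F (k + i))" for i
  proof -
    have [measurable]: "Z \<in> borel_measurable (F (k + i))"
      by (rule measurable_from_subalg[OF sub' Z]) simp
    note BF[measurable]
    show ?thesis unfolding c_def by measurable
  qed
  have c_int: "integrable M c"
  proof (rule integrable_const_bound[of _ "lam * R"])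
    show "AE \<omega> in M. norm (c \<omega>) \<le> lam * R"
      using lam R by (intro AE_I2) (auto simp: c_def B_def indicator_def norm_minus_commute)
  qed (rule measurable_from_subalg[OF sub cF[of 0]])
  have Q_eq: "Q i \<omega> = c \<omega> + lam *\<^sub>R (indicat_real B \<omega> *\<^sub>R (X (Suc (k + i)) \<omega> - \<mu>))" for i \<omega>
    by (simp add: Q_def c_def Y_def algebra_simps)
  have Xmu_int: "integrable M (\<lambda>\<omega>. X (Suc (k + i)) \<omega> - \<mu>)" for i using mean_int[of "Suc (k + i)"] by simp
  have Q_ce: "is_cond_exp M (F (k + i)) (Q i) c" for i
  proof -
    have BX: "integrable M (\<lambda>\<omega>. lam *\<^sub>R (indicat_real B \<omega> *\<^sub>R (X (Suc (k + i)) \<omega> - \<mu>)))"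
      by (intro integrable_scaleR_right integrable_mult_indicator BM Xmu_int)
    then have "integrable M (Q i)" unfolding Q_eq using c_int by (rule Bochner_Integration.integrable_add[rotated])
    moreover have "(\<integral>\<omega>\<in>A. Q i \<omega> \<partial>M) = (\<integral>\<omega>\<in>A. c \<omega> \<partial>M)" if A: "A \<in> sets (F (k + i))" for A
    proof -
      have AM[measurable]: "A \<in> sets M" by (rule sets_M[OF A])
      \<comment> \<open>Because \<open>B\<close> is already in \<open>F (k + i)\<close>, the
        hypothesis on the mean applies to \<open>A \<inter> B\<close> and centres the increments
        restricted to \<open>B\<close>.\<close>
      have AB: "A \<inter> B \<in> sets (F (k + i))" using A BF by auto
      have "(\<integral>\<omega>\<in>A \<inter> B. X (Suc (k + i)) \<omega> - \<mu> \<partial>M) = 0"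
      proof -
        have "(\<integral>\<omega>\<in>A \<inter> B. X (Suc (k + i)) \<omega> - \<mu> \<partial>M)
            = (\<integral>\<omega>\<in>A \<inter> B. X (Suc (k + i)) \<omega> \<partial>M) - (\<integral>\<omega>\<in>A \<inter> B. \<mu> \<partial>M)"
          using sets_M[OF AB] mean_int[of "Suc (k + i)"]
          by (intro set_integral_diff) (auto simp: set_integrable_def intro!: integrable_mult_indicator)
        also have "(\<integral>\<omega>\<in>A \<inter> B. \<mu> \<partial>M) = measure M (A \<inter> B) *\<^sub>R \<mu>"
          using sets_M[OF AB] integrable_mult_indicator[OF sets_M[OF AB] integrable_const[of "1::real"]]
          by (simp add: set_lebesgue_integral_def integral_scaleR_left)
        finally show ?thesis using mean[of "Suc (k + i)" "A \<inter> B"] AB by simp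
      qed
      moreover have "indicat_real A \<omega> *\<^sub>R (lam *\<^sub>R (indicat_real B \<omega> *\<^sub>R (X (Suc (k + i)) \<omega> - \<mu>)))
          = lam *\<^sub>R (indicat_real (A \<inter> B) \<omega> *\<^sub>R (X (Suc (k + i)) \<omega> - \<mu>))" for \<omega>
        by (auto simp: indicator_def)
      ultimately have "(\<integral>\<omega>. indicat_real A \<omega> *\<^sub>R (lam *\<^sub>R (indicat_real B \<omega> *\<^sub>R (X (Suc (k + i)) \<omega> - \<mu>))) \<partial>M) = 0"
        by (simp only: set_lebesgue_integral_def integral_scaleR_right scaleR_zero_right)
      then show ?thesis
        unfolding set_lebesgue_integral_def Q_eq scaleR_add_right
        using integrable_mult_indicator[OF AM BX] integrable_mult_indicator[OF AM c_int]
        by (subst Bochner_Integration.integral_add) auto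
    qed
    ultimately show ?thesis using c_int cF by (auto simp: is_cond_exp_def)
  qed
  have "\<exists>D. is_cond_exp M (F (k + i)) (T i) D \<and> (\<forall>\<omega>. norm (D \<omega>) \<le> 1)" for i
    by (rule is_cond_exp_bounded_exists[OF smooth fin sfs TM T1]) simp
  then obtain D where D: "\<And>i. is_cond_exp M (F (k + i)) (T i) (D i)" "\<And>i \<omega>. norm (D i \<omega>) \<le> 1" by metis
  have bias: "AE \<omega> in M. norm (D i \<omega> - c \<omega>) \<le> b" for i
  proof (rule AE_le_of_set_integral_le[OF fin sub[of "k + i"]])
    have ce: "is_cond_exp M (F (k + i)) (\<lambda>\<omega>. T i \<omega> - Q i \<omega>) (\<lambda>\<omega>. D i \<omega> - c \<omega>)"
      by (rule is_cond_exp_diff[OF sub D(1) Q_ce])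
    then have *: "integrable M (\<lambda>\<omega>. T i \<omega> - Q i \<omega>)" "integrable M (\<lambda>\<omega>. D i \<omega> - c \<omega>)"
      "(\<lambda>\<omega>. D i \<omega> - c \<omega>) \<in> borel_measurable (F (k + i))" by (auto simp: is_cond_exp_def)
    show "(\<lambda>\<omega>. norm (D i \<omega> - c \<omega>)) \<in> borel_measurable (F (k + i))" using *(3) by measurable
    show "integrable M (\<lambda>\<omega>. norm (D i \<omega> - c \<omega>))" using *(2) by (rule integrable_norm)
    fix A assume A: "A \<in> sets (F (k + i))"
    have "(\<integral>\<omega>\<in>A. norm (D i \<omega> - c \<omega>) \<partial>M) \<le> (\<integral>\<omega>\<in>A. norm (T i \<omega> - Q i \<omega>) \<partial>M)"
      by (rule is_cond_exp_norm_le[OF smooth sub ce A])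
    also have "\<dots> \<le> K_const p * (V * measure M A)"
    proof (rule bound_int[OF A])
      show "integrable M (\<lambda>\<omega>. norm (T i \<omega> - Q i \<omega>))" using *(1) by (rule integrable_norm)
      show "norm (T i \<omega> - Q i \<omega>) \<le> K_const p * U i \<omega>" for \<omega>
        using norm_Trunc_diff_le[OF lam p, of "Y i \<omega>"] by (auto simp: T_def Q_def U_def indicator_def)
      show "0 \<le> K_const p" using K_const_pos[OF p(1)] by simp
    qed
    finally show "(\<integral>\<omega>\<in>A. norm (D i \<omega> - c \<omega>) \<partial>M) \<le> b * measure M A" by (simp add: b_def)
  qed
  then have "AE \<omega> in M. \<forall>i. norm (D i \<omega> - c \<omega>) \<le> b" by (simp add: AE_all_countable)
  \<comment> \<open>One null set for all \<open>i\<close> lets the final estimate be carried out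
    pointwise.\<close>
  then obtain N0 where N0: "{\<omega> \<in> space M. \<not> (\<forall>i. norm (D i \<omega> - c \<omega>) \<le> b)} \<subseteq> N0" "N0 \<in> sets M" "emeasure M N0 = 0"
    by (rule AE_E)
  define \<kappa> where "\<kappa> = (if is_hilbert TYPE('b) then 1 else 4) * V * ((exp (2 / \<beta>) - 2 / \<beta> - 1) / (2 / \<beta>)\<^sup>2)"
  define E1 where "E1 = {\<omega> \<in> space M. \<exists>n\<le>N. \<beta> * ln (2 / \<alpha>) + \<beta> * \<kappa> * real n \<le> norm (\<Sum>i<n. T i \<omega> - D i \<omega>)}"
  have E1: "E1 \<in> sets M" "measure M E1 \<le> \<alpha>"
  proof -
    have 1: "\<And>i. sigma_finite_subalgebra M (H i)" "\<And>i j. i \<le> j \<Longrightarrow> sets (H i) \<subseteq> sets (H j)"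
      "\<And>i. is_cond_exp M (H i) (T i) (D i)"
      using sfs mono D(1) by (auto simp: H_def)
    note tail = martingale_tail[where G = H and T = T and D = D and N = N,
        OF smooth beta prob 1(1,2) T_meas T1 1(3) D(2) V0 T_sq \<alpha> \<kappa>_def]
    show "E1 \<in> sets M" unfolding E1_def by (rule tail(1))
    show "measure M E1 \<le> \<alpha>" unfolding E1_def by (rule tail(2))
  qed
  define E2 where "E2 = {\<omega> \<in> space M. R \<le> norm (Z \<omega> - \<mu>)}"
  have E2: "E2 \<in> sets M" unfolding E2_def by measurable
  define G where "G = E1 \<union> E2 \<union> N0"
  have GM: "G \<in> sets M" using E1 E2 N0 by (auto simp: G_def)
  have "measure M G \<le> measure M E1 + measure M E2 + measure M N0"
    unfolding G_def using E1(1) E2 N0(2)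
    by (intro order_trans[OF measure_Un_le] add_right_mono measure_Un_le) auto
  also have "\<dots> \<le> 2 * \<alpha>" using E1(2) R(2) N0(3) by (simp add: E2_def[symmetric] measure_def)
  finally have Gm: "measure M G \<le> 2 * \<alpha>" .
  have final: "norm (muhat_est X (Z \<omega>) lam k n \<omega> - \<mu>) \<le> \<beta> * ln (2 / \<alpha>) / (lam * (real n - real k))
       + lam powr (p - 1) * ((\<beta> * C_space p \<beta> TYPE('b) + 2 powr (p - 1) * K_const p) * (v + R powr p))"
    if \<omega>: "\<omega> \<in> space M - G" and n: "k < n" "n \<le> N" for \<omega> n
  proof -
    define l where "l = n - k"
    have l: "0 < l" "n = k + l" "l \<le> N" "real n - real k = real l" using n by (auto simp: l_def)
    have \<omega>B: "\<omega> \<in> B" using \<omega> by (auto simp: G_def E2_def B_def)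
    have Dc: "norm (D i \<omega> - c \<omega>) \<le> b" for i using \<omega> N0(1) by (auto simp: G_def)
    have S: "norm (\<Sum>i<l. T i \<omega> - D i \<omega>) \<le> \<beta> * ln (2 / \<alpha>) + \<beta> * \<kappa> * real l"
      using \<omega> l(3) by (force simp: G_def E1_def)
    \<comment> \<open>Martingale part plus accumulated bias, the latter at most \<open>b\<close> per
      observation.\<close>
    have "(\<Sum>i<l. T i \<omega> - c \<omega>) = (\<Sum>i<l. T i \<omega> - D i \<omega>) + (\<Sum>i<l. D i \<omega> - c \<omega>)"
      by (simp flip: sum.distrib)
    also have "norm \<dots> \<le> (\<beta> * ln (2 / \<alpha>) + \<beta> * \<kappa> * real l) + real l * b"
      using S sum_norm_bound[of "{..<l}" "\<lambda>i. D i \<omega> - c \<omega>" b] Dc by (intro norm_triangle_mono) auto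
    finally have sum_le: "norm (\<Sum>i<l. T i \<omega> - c \<omega>) \<le> \<beta> * ln (2 / \<alpha>) + real l * (\<beta> * \<kappa> + b)"
      by (simp add: algebra_simps)
    define f where "f = (\<lambda>m. Trunc (lam *\<^sub>R (X m \<omega> - Z \<omega>)) *\<^sub>R (X m \<omega> - Z \<omega>) + Z \<omega>)"
    have reindex: "(\<Sum>m\<in>{k<..n}. f m) = (\<Sum>i<l. f (Suc (k + i)))"
      unfolding l(2) by (rule sum.reindex_bij_witness[of _ "\<lambda>i. Suc (k + i)" "\<lambda>m. m - Suc k"]) auto
    \<comment> \<open>On \<open>B\<close> the difference is \<open>lam\<close> times the error of a
      single summand, so dividing the sum by \<open>lam * real l\<close> recovers the error of the
      estimator.\<close>
    have Tc: "T i \<omega> - c \<omega> = lam *\<^sub>R (f (Suc (k + i)) - \<mu>)" for i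
      using \<omega>B by (simp add: T_def c_def f_def Y_def algebra_simps)
    have "muhat_est X (Z \<omega>) lam k n \<omega> - \<mu> = (1 / real l) *\<^sub>R (\<Sum>i<l. f (Suc (k + i))) - \<mu>"
      unfolding reindex[symmetric] by (simp add: muhat_est_def l(4) f_def)
    also have "\<dots> = (1 / real l) *\<^sub>R (\<Sum>i<l. f (Suc (k + i)) - \<mu>)"
      using l(1) by (simp add: sum_subtractf scaleR_diff_right sum_constant_scaleR)
    also have "\<dots> = (1 / (lam * real l)) *\<^sub>R (\<Sum>i<l. T i \<omega> - c \<omega>)"
      unfolding Tc scaleR_sum_right[symmetric] using lam by simp
    finally have "norm (muhat_est X (Z \<omega>) lam k n \<omega> - \<mu>) = norm (\<Sum>i<l. T i \<omega> - c \<omega>) / (lam * real l)"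
      using lam by simp
    also have "\<dots> \<le> (\<beta> * ln (2 / \<alpha>) + real l * (\<beta> * \<kappa> + b)) / (lam * real l)"
      using sum_le lam by (intro divide_right_mono) auto
    also have "\<dots> = \<beta> * ln (2 / \<alpha>) / (lam * real l) + (\<beta> * \<kappa> + b) / lam"
      using l(1) lam by (simp add: add_divide_distrib)
    also have "(\<beta> * \<kappa> + b) / lam = lam powr (p - 1) * ((\<beta> * C_space p \<beta> TYPE('b) + 2 powr (p - 1) * K_const p) * (v + R powr p))"
    proof -
      \<comment> \<open>Reconciles the factor 4 from centring outside Hilbert spaces with the
        exponent \<open>p + 1\<close> in \<open>C_space\<close>.\<close>
      have four: "2 powr (p + 1) = 4 * 2 powr (p - 1)"
        using powr_add[of "2::real" "p - 1" 2] by (simp add: add.commute)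
      have "\<kappa> = C_space p \<beta> TYPE('b) * (lam powr p * (v + R powr p))"
        unfolding \<kappa>_def V_def C_space_def four by simp
      moreover have "lam powr (p - 1) = lam powr p / lam" using lam by (simp add: powr_diff)
      ultimately show ?thesis by (simp add: b_def V_def algebra_simps add_divide_distrib)
    qed
    finally show ?thesis unfolding l(4) .
  qed
  show ?thesis using GM Gm final by blast
qed

section \<open>Union bound over the dyadic blocks\<close>

theorem theorem2:
  fixes M :: "'a measure"
    and F :: "nat \<Rightarrow> 'a measure"
    and X :: "nat \<Rightarrow> 'a \<Rightarrow> 'b::{banach, second_countable_topology}"
    and \<mu> :: 'b
    and \<beta> p v \<delta> :: real
    and h :: "real \<Rightarrow> real"
    and n0 :: nat
    and k :: "nat \<Rightarrow> nat"
    and Zhat :: "nat \<Rightarrow> (nat \<Rightarrow> 'b) \<Rightarrow> 'b"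
    and r :: "real \<Rightarrow> nat \<Rightarrow> real"
  defines "Zj \<equiv> \<lambda>j \<omega>. Zhat (k j) (restrict (\<lambda>i. X i \<omega>) {1..k j})"
    and "Cj \<equiv> \<lambda>j. (\<beta> * C_space p \<beta> TYPE('b) + 2 powr (p - 1) * K_const p) *
                  (v + r ((\<delta> / h (real j)) / 2) (k j) powr p)"
    and "rn \<equiv> \<lambda>n. r (\<delta> / (2 * h (real (flog2 n)))) (k (flog2 n))"
  assumes prob: "prob_space M"
    and smooth: "beta_smooth \<beta> TYPE('b)" and beta_pos: "\<beta> > 0"
    and filt_sub: "\<And>n. sigma_finite_subalgebra M (F n)"
    and filt_mono: "\<And>n m. n \<le> m \<Longrightarrow> sets (F n) \<subseteq> sets (F m)"
    and adapted: "\<And>n. n \<ge> 1 \<Longrightarrow> X n \<in> borel_measurable (F n)"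
    and mean_int: "\<And>n. n \<ge> 1 \<Longrightarrow> integrable M (X n)"
    and mean: "\<And>n A. n \<ge> 1 \<Longrightarrow> A \<in> sets (F (n - 1)) \<Longrightarrow>
                 set_lebesgue_integral M A (X n) = measure M A *\<^sub>R \<mu>"
    and p_range: "1 < p" "p \<le> 2"
    and v_pos: "v > 0"
    and moment: "AE \<omega> in M. \<forall>n\<ge>1.
                 nn_cond_exp M (F (n - 1)) (\<lambda>\<omega>. ennreal (norm (X n \<omega> - \<mu>) powr p)) \<omega> \<le> ennreal v"
    and h_nonneg: "\<And>x. x \<ge> 0 \<Longrightarrow> h x \<ge> 0"
    and h_pos: "\<And>n::nat. n \<ge> 1 \<Longrightarrow> h (real n) > 0"
    and h_summable: "summable (\<lambda>n. 1 / h (real (Suc n)))"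
    and h_sum: "(\<Sum>n. 1 / h (real (Suc n))) \<le> 1"
    and n0_pos: "n0 \<ge> 1"
    and k_mono: "mono k"
    and k_small_o: "(\<lambda>n. real (k (flog2 n))) \<in> o(\<lambda>n. real n)"
    and k_half: "\<And>l. l \<ge> n0 \<Longrightarrow> real (k l) \<le> real l / 2"
    and Zhat_meas: "\<And>m. Zhat m \<in> borel_measurable (Pi\<^sub>M {1..m} (\<lambda>_. borel))"
    and r_conc: "\<And>d j. 0 < d \<Longrightarrow> d < 1 \<Longrightarrow>
                 measure M {\<omega> \<in> space M. norm (Zj j \<omega> - \<mu>) \<ge> r d (k j)} \<le> d"
    and delta: "0 < \<delta>" "\<delta> < 1"
  shows "\<exists>E\<in>sets M. measure M E \<ge> 1 - \<delta> \<and>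
           (\<forall>\<omega>\<in>E. \<forall>n. n \<ge> n0 \<and> n \<ge> 2 \<longrightarrow>
              norm (muhat_est X (Zj (flog2 n) \<omega>)
                   (((\<beta> * ln (4 / (\<delta> / h (real (flog2 n)))) / (2 ^ (flog2 n) * Cj (flog2 n))) powr (1 / p)))
                   (k (flog2 n)) n \<omega> - \<mu>) \<le>
                B_space p \<beta> TYPE('b) * (v + rn n powr p) powr (1 / p) *
                (\<beta> * ln (4 * h (real (flog2 n)) / \<delta>) / (real n - real (k (flog2 n)))) powr ((p - 1) / p))"
proof -
  interpret prob_space M by fact
  have sub: "subalgebra M (F n)" for n using filt_sub by (simp add: sigma_finite_subalgebra_def)
  \<comment> \<open>Each reciprocal is one term of a nonnegative series with sum at most 1. Hence
    \<open>dj j < 1\<close>, and the concentration hypothesis is available at level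
    \<open>dj j / 2\<close>.\<close>
  have h_ge_1: "1 \<le> h (real j)" if j: "1 \<le> j" for j :: nat
  proof -
    obtain i where i: "j = Suc i" using j by (cases j) auto
    have "(\<Sum>n\<in>{i}. 1 / h (real (Suc n))) \<le> (\<Sum>n. 1 / h (real (Suc n)))"
      using h_summable h_pos[of "Suc _"] by (intro sum_le_suminf) (auto intro: less_imp_le)
    then have "1 / h (real j) \<le> 1" using h_sum i by simp
    then show ?thesis using h_pos[OF j] by simp
  qed
  define dj where "dj = (\<lambda>j. \<delta> / h (real j))"
  have dj: "0 < dj j" "dj j < 1" if "1 \<le> j" for j
  proof -
    have "\<delta> / h (real j) \<le> \<delta> / 1"
      using delta h_ge_1[OF that] by (intro divide_left_mono) auto
    then show "dj j < 1" using delta by (simp add: dj_def)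
    show "0 < dj j" using delta h_pos[OF that] by (simp add: dj_def)
  qed
  define R where "R = (\<lambda>j. r (dj j / 2) (k j))"
  define lam where "lam = (\<lambda>j. (\<beta> * ln (4 / dj j) / (2 ^ j * Cj j)) powr (1 / p))"
  define Q where "Q = \<beta> * C_space p \<beta> TYPE('b) + 2 powr (p - 1) * K_const p"
  have Q: "0 < Q"
    unfolding Q_def using beta_pos C_space_pos[OF beta_pos] K_const_pos[OF p_range(1)] by (intro add_pos_pos mult_pos_pos) auto
  have Cj: "Cj j = Q * (v + R j powr p)" for j by (simp add: Cj_def Q_def R_def dj_def)
  have Cj_pos: "0 < Cj j" for j unfolding Cj using Q v_pos by (intro mult_pos_pos add_pos_nonneg) auto
  have ln_pos: "0 < ln (4 / dj j)" if "1 \<le> j" for j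
    using dj[OF that] by (intro ln_gt_zero) (simp add: field_simps)
  have lam_pos: "0 < lam j" if "1 \<le> j" for j
    using beta_pos ln_pos[OF that] Cj_pos[of j] by (simp add: lam_def)
  have Z_meas: "Zj j \<in> borel_measurable (F (k j))" for j
  proof -
    have "X i \<in> borel_measurable (F (k j))" if "i \<in> {1..k j}" for i
    proof (rule measurable_from_subalg[OF _ adapted])
      show "subalgebra (F (k j)) (F i)" using sub filt_mono that by (auto simp: subalgebra_def)
    qed (use that in auto)
    then have "(\<lambda>\<omega>. restrict (\<lambda>i. X i \<omega>) {1..k j}) \<in> measurable (F (k j)) (Pi\<^sub>M {1..k j} (\<lambda>_. borel))"
      by (rule measurable_restrict)
    then show ?thesis unfolding Zj_def by (rule measurable_compose[OF _ Zhat_meas])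
  qed
  have R_conc: "measure M {\<omega> \<in> space M. R j \<le> norm (Zj j \<omega> - \<mu>)} \<le> dj j / 2" if "1 \<le> j" for j
    unfolding R_def using dj[OF that] by (intro r_conc) auto
  \<comment> \<open>A nonpositive radius would make the deviation event the whole space.\<close>
  have R_pos: "0 < R j" if "1 \<le> j" for j
  proof (rule ccontr)
    assume "\<not> 0 < R j"
    then have "R j \<le> norm (Zj j \<omega> - \<mu>)" for \<omega> using norm_ge_zero[of "Zj j \<omega> - \<mu>"] by linarith
    then have "measure M (space M) \<le> dj j / 2" using R_conc[OF that] by simp
    then show False using dj[OF that] by (simp add: prob_space)
  qed
  \<comment> \<open>Here \<alpha> is \<open>dj j / 2\<close>: the bad set of a block costs
    \<open>dj j\<close> in all, and \<open>2 / (dj j / 2)\<close> is the \<open>4 / dj j\<close>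
    that was built into \<open>lam j\<close>.\<close>
  have "\<exists>G\<in>sets M. measure M G \<le> 2 * (dj j / 2) \<and> (\<forall>\<omega>\<in>space M - G. \<forall>n. k j < n \<and> n \<le> 2 ^ Suc j \<longrightarrow>
     norm (muhat_est X (Zj j \<omega>) (lam j) (k j) n \<omega> - \<mu>) \<le> \<beta> * ln (2 / (dj j / 2)) / (lam j * (real n - real (k j)))
       + lam j powr (p - 1) * ((\<beta> * C_space p \<beta> TYPE('b) + 2 powr (p - 1) * K_const p) * (v + R j powr p)))"
    if j: "1 \<le> j" for j
    by (rule block_bound[OF prob smooth beta_pos filt_sub filt_mono adapted mean_int mean p_range v_pos moment
          Z_meas R_pos[OF j] R_conc[OF j] lam_pos[OF j]]) (use dj[OF j] in auto)
  then have "\<forall>j. \<exists>G. 1 \<le> j \<longrightarrow> G \<in> sets M \<and> measure M G \<le> dj j \<and> (\<forall>\<omega>\<in>space M - G. \<forall>n. k j < n \<and> n \<le> 2 ^ Suc j \<longrightarrow>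
     norm (muhat_est X (Zj j \<omega>) (lam j) (k j) n \<omega> - \<mu>) \<le> \<beta> * ln (4 / dj j) / (lam j * (real n - real (k j)))
       + lam j powr (p - 1) * (Q * (v + R j powr p)))"
    unfolding Q_def by (auto 0 0 simp: Bex_def)
  then obtain G where G: "\<And>j. 1 \<le> j \<Longrightarrow> G j \<in> sets M" "\<And>j. 1 \<le> j \<Longrightarrow> measure M (G j) \<le> dj j"
    and bound: "\<And>j \<omega> n. 1 \<le> j \<Longrightarrow> \<omega> \<in> space M - G j \<Longrightarrow> k j < n \<Longrightarrow> n \<le> 2 ^ Suc j \<Longrightarrow>
      norm (muhat_est X (Zj j \<omega>) (lam j) (k j) n \<omega> - \<mu>) \<le> \<beta> * ln (4 / dj j) / (lam j * (real n - real (k j)))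
       + lam j powr (p - 1) * (Q * (v + R j powr p))"
    by metis
  define E where "E = space M - (\<Union>i. G (Suc i))"
  have UG: "(\<Union>i. G (Suc i)) \<in> sets M" using G(1) by auto
  have "measure M (\<Union>i. G (Suc i)) \<le> \<delta>"
  proof -
    have sm: "summable (\<lambda>i. dj (Suc i))"
      using summable_mult[OF h_summable, of \<delta>] by (simp add: dj_def)
    have sm': "summable (\<lambda>i. measure M (G (Suc i)))"
      by (rule summable_comparison_test'[OF sm, of 0]) (use G(2) in auto)
    have "measure M (\<Union>i. G (Suc i)) \<le> (\<Sum>i. measure M (G (Suc i)))"
      using G(1) sm' by (intro finite_measure_subadditive_countably) auto
    also have "\<dots> \<le> (\<Sum>i. dj (Suc i))" using G(2) by (intro suminf_le sm sm') auto
    also have "\<dots> = \<delta> * (\<Sum>i. 1 / h (real (Suc i)))"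
      using suminf_mult[OF h_summable, of \<delta>] by (simp add: dj_def)
    also have "\<dots> \<le> \<delta> * 1" using h_sum delta by (intro mult_left_mono) auto
    finally show ?thesis by simp
  qed
  then have E_prob: "measure M E \<ge> 1 - \<delta>" unfolding E_def using prob_compl[OF UG] by simp
  have E_sets: "E \<in> sets M" using UG by (auto simp: E_def)
  have "norm (muhat_est X (Zj (flog2 n) \<omega>)
                   (((\<beta> * ln (4 / (\<delta> / h (real (flog2 n)))) / (2 ^ (flog2 n) * Cj (flog2 n))) powr (1 / p)))
                   (k (flog2 n)) n \<omega> - \<mu>) \<le>
                B_space p \<beta> TYPE('b) * (v + rn n powr p) powr (1 / p) *
                (\<beta> * ln (4 * h (real (flog2 n)) / \<delta>) / (real n - real (k (flog2 n)))) powr ((p - 1) / p)"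
    if \<omega>: "\<omega> \<in> E" and n: "n0 \<le> n" "2 \<le> n" for \<omega> n
  proof -
    define j where "j = flog2 n"
    note fl = flog2_bounds[OF n(2), folded j_def]
    \<comment> \<open>\<open>n \<ge> 2\<close> makes the block index at least 1, so
      \<open>G j\<close> is one of the sets removed from \<open>E\<close>.\<close>
    obtain i where i: "j = Suc i" using fl(3) by (cases j) auto
    have \<omega>G: "\<omega> \<in> space M - G j" using \<omega> unfolding E_def i by blast
    \<comment> \<open>The half bound on \<open>k\<close> is taken at \<open>n\<close>, since the
      block index \<open>j\<close> may lie below \<open>n0\<close>; monotonicity brings it back to
      \<open>k j\<close>.\<close>
    have "k j \<le> k n" using k_mono fl(4) by (rule monoD)
    then have kn: "real (k j) \<le> real n / 2" using k_half[OF n(1)] by linarith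
    define l where "l = real n - real (k j)"
    have l: "0 < l" "real n \<le> 2 * l" "l \<le> real n" using kn n(2) by (auto simp: l_def)
    have knat: "k j < n" using l(1) by (simp add: l_def)
    have J: "(2::real) ^ j \<le> real n" "real n < 2 * 2 ^ j"
    proof -
      have "real (2 ^ j) \<le> real n" "real n < real (2 ^ Suc j)"
        using fl(1,2) by (simp_all only: of_nat_le_iff of_nat_less_iff)
      then show "(2::real) ^ j \<le> real n" "real n < 2 * 2 ^ j" by simp_all
    qed
    have "norm (muhat_est X (Zj j \<omega>) (lam j) (k j) n \<omega> - \<mu>)
        \<le> \<beta> * ln (4 / dj j) / (lam j * l) + lam j powr (p - 1) * (Q * (v + R j powr p))"
      unfolding l_def using fl by (intro bound \<omega>G knat) auto
    also have "\<dots> \<le> (2 powr ((p - 1) / p) + 2 powr (1 / p)) * Q powr (1 / p) * (v + R j powr p) powr (1 / p)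
        * (\<beta> * ln (4 / dj j) / l) powr ((p - 1) / p)"
    \<comment> \<open>\<open>l\<close> lies between \<open>n / 2\<close> and \<open>n\<close>, and
      \<open>n\<close> between \<open>2 ^ j\<close> and \<open>2 * 2 ^ j\<close>; chaining these
      gives both factor-two comparisons.\<close>
    proof (rule balanced_rate_le[where J = "2 ^ j"])
      show "0 < \<beta> * ln (4 / dj j)" using beta_pos ln_pos[OF fl(3)] by simp
      show "0 < v + R j powr p" using v_pos by (intro add_pos_nonneg) auto
      show "l \<le> 2 * 2 ^ j" using J l by linarith
      show "2 ^ j \<le> 2 * l" using J l by linarith
      show "lam j = (\<beta> * ln (4 / dj j) / (2 ^ j * (Q * (v + R j powr p)))) powr (1 / p)"
        by (simp add: lam_def Cj)
    qed (use Q l p_range in auto)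
    also have "\<dots> = B_space p \<beta> TYPE('b) * (v + rn n powr p) powr (1 / p) *
                (\<beta> * ln (4 * h (real j) / \<delta>) / l) powr ((p - 1) / p)"
    proof -
      have "rn n = R j" by (simp add: rn_def R_def dj_def j_def mult.commute)
      moreover have "B_space p \<beta> TYPE('b) = (2 powr ((p - 1) / p) + 2 powr (1 / p)) * Q powr (1 / p)"
        by (simp add: B_space_def Q_def mult.commute)
      moreover have "4 / dj j = 4 * h (real j) / \<delta>" by (simp add: dj_def)
      ultimately show ?thesis by simp
    qed
    finally show ?thesis by (simp only: j_def[symmetric] l_def lam_def dj_def)
  qed
  then show ?thesis using E_sets E_prob by blast
qed

end
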